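(* Let $\alpha$ be an $E_0$-semigroup on a $\mathrm{II}_1$ factor $\mathrm{M}$. There exists a linear isometry $D$ from the Hilbert space $H(G(\alpha))$ into the closed linear subspace $$\overline{\mathrm{Span}}\{b_1:\ b \text{ is a centred additive cocycle in } (G^\alpha_t)_{t\ge0}\}$$ of $L^2(\mathrm{M})$.
   Context: An $E_0$-semigroup on a von Neumann algebra $\mathrm{M}$ is a semigroup $(\alpha_t)_{t\ge 0}$ of normal unital $*$-endomorphisms of $\mathrm{M}$ with $\alpha_0=\mathrm{id}$, $\alpha_t(\mathrm{M})\ne \mathrm{M}$ for all $t>0$, and $t\mapsto\rho(\alpha_t(x))$ continuous for all $x\in\mathrm{M}$, $\rho\in\mathrm{M}_*$. A cocycle for $\alpha$ is a strongly continuous family of unitaries $(U_t)_{t\ge0}$ in $\mathrm{M}$ with $U_s\alpha_s(U_t)=U_{s+t}$ for all $s,t\ge 0$. Let $\mathrm{M}$ be a $\mathrm{II}_1$ factor with trace $\tau$ acting standardly on $H=L^2(\mathrm{M})$ with cyclic and separating trace vector $\Omega$. A gauge cocycle for $\alpha$ is a cocycle $U$ with $U_t\in\mathrm{M}\cap\alpha_t(\mathrm{M})'$ for all $t\ge0$; the gauge cocycles form a group $G(\alpha)$ under $(UV)_t=U_tV_t$. For $U,V\in G(\alpha)$ there is a unique $c_*(U,V)\in\mathbb{C}$ with $\tau(U_t^*V_t)=e^{c_*(U,V)t}$ for all $t\ge0$. The form $\langle f,g\rangle=\sum_{U,V}c_*(U,V)\overline{f(U)}g(V)$ is positive semidefinite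 on the space of finitely supported functions $f:G(\alpha)\to\mathbb{C}$ with $\sum_Uf(U)=0$; $H(G(\alpha))$ is the Hilbert space obtained by quotienting by null vectors and completing. The canonical unit is the semigroup of isometries $S_t$ on $H$ with $S_tx\Omega=\alpha_t(x)\Omega$ ($x\in\mathrm{M}$). Let $\mathrm{A}_{0,t}$ be the von Neumann algebra generated by $\{U_s:U\in G(\alpha),\ 0\le s\le t\}$, and $G^\alpha_t$ the closure of $\mathrm{A}_{0,t}\Omega$ in $H$. An additive cocycle in $(G^\alpha_t)$ is a measurable family $b_t\in G^\alpha_t$, $t\ge0$, with $b_{s+t}=b_s+S_sb_t$ for all $s,t\ge0$; it is centred if $\langle\Omega,b_t\rangle=0$ for all $t\ge0$. *)

theory Defs
  imports "HOL-Analysis.Analysis"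
begin

section \<open>Complex Hilbert spaces\<close>

text \<open>The inner product is conjugate-linear in the first and linear in the second variable. The
  last axiom identifies the norm of the underlying real Hilbert space with the norm of the complex one.\<close>

class chilbert_space = real_inner + complete_space +
  fixes cscale :: "complex \<Rightarrow> 'a \<Rightarrow> 'a"  (infixr \<open>*\<^sub>C\<close> 75)
    and cinner :: "'a \<Rightarrow> 'a \<Rightarrow> complex"
  assumes cscale_add_right: "c *\<^sub>C (x + y) = c *\<^sub>C x + c *\<^sub>C y"
    and cscale_add_left: "(c + d) *\<^sub>C x = c *\<^sub>C x + d *\<^sub>C x"
    and cscale_cscale: "c *\<^sub>C d *\<^sub>C x = (c * d) *\<^sub>C x"
    and cscale_of_real: "complex_of_real r *\<^sub>C x = r *\<^sub>R x"
    and cinner_commute: "cinner x y = cnj (cinner y x)"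
    and cinner_add_right: "cinner x (y + z) = cinner x y + cinner x z"
    and cinner_cscale_right: "cinner x (c *\<^sub>C y) = c * cinner x y"
    and inner_eq_Re_cinner: "inner x y = Re (cinner x y)"

lemma vector_space_cscale: "vector_space (cscale :: complex \<Rightarrow> 'a \<Rightarrow> 'a::chilbert_space)"
proof
  fix x :: 'a
  show "1 *\<^sub>C x = x"
    using cscale_of_real[of 1 x] by simp
qed (simp_all add: cscale_add_right cscale_add_left cscale_cscale)

lemma cinner_self: "cinner x x = complex_of_real ((norm x)\<^sup>2)"
  using cinner_commute[of x x] inner_eq_Re_cinner[of x x]
  by (simp add: complex_eq_iff power2_norm_eq_inner)


section \<open>Von Neumann algebras\<close>

definition bounded_ops :: "('h::chilbert_space \<Rightarrow> 'h) set" where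
  "bounded_ops = {T. Vector_Spaces.linear cscale cscale T \<and> bounded_linear T}"

definition adj :: "('h::chilbert_space \<Rightarrow> 'h) \<Rightarrow> 'h \<Rightarrow> 'h" where
  "adj T = (THE S. S \<in> bounded_ops \<and> (\<forall>x y. cinner (S x) y = cinner x (T y)))"

definition commutant :: "('h::chilbert_space \<Rightarrow> 'h) set \<Rightarrow> ('h \<Rightarrow> 'h) set" where
  "commutant A = {T \<in> bounded_ops. \<forall>S\<in>A. T \<circ> S = S \<circ> T}"

definition von_neumann_algebra :: "('h::chilbert_space \<Rightarrow> 'h) set \<Rightarrow> bool" where
  "von_neumann_algebra M \<longleftrightarrow>
     M \<subseteq> bounded_ops \<and> (\<forall>x\<in>M. adj x \<in> M) \<and> commutant (commutant M) = M"

definition vn_generated :: "('h::chilbert_space \<Rightarrow> 'h) set \<Rightarrow> ('h \<Rightarrow> 'h) set" where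
  "vn_generated A = \<Inter>{N. von_neumann_algebra N \<and> A \<subseteq> N}"

definition unitary :: "('h::chilbert_space \<Rightarrow> 'h) \<Rightarrow> bool" where
  "unitary u \<longleftrightarrow> u \<in> bounded_ops \<and> adj u \<circ> u = id \<and> u \<circ> adj u = id"

text \<open>The predual consists of the ultraweakly continuous functionals. Only the values of
  \<open>\<rho>\<close> on \<open>M\<close> matter.\<close>

definition in_predual ::
  "('h::chilbert_space \<Rightarrow> 'h) set \<Rightarrow> (('h \<Rightarrow> 'h) \<Rightarrow> complex) \<Rightarrow> bool" where
  "in_predual M \<rho> \<longleftrightarrow>
     (\<exists>\<xi> \<eta> :: nat \<Rightarrow> 'h. summable (\<lambda>n. (norm (\<xi> n))\<^sup>2) \<and> summable (\<lambda>n. (norm (\<eta> n))\<^sup>2) \<and>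
        (\<forall>x\<in>M. \<rho> x = (\<Sum>n. cinner (\<xi> n) (x (\<eta> n)))))"


subsection \<open>Factors of type \<open>II\<^sub>1\<close> in standard form\<close>

definition factor :: "('h::chilbert_space \<Rightarrow> 'h) set \<Rightarrow> bool" where
  "factor M \<longleftrightarrow> von_neumann_algebra M \<and> M \<inter> commutant M = range cscale"

definition projections :: "('h::chilbert_space \<Rightarrow> 'h) set \<Rightarrow> ('h \<Rightarrow> 'h) set" where
  "projections M = {p \<in> M. p \<circ> p = p \<and> adj p = p}"

definition proj_le :: "('h \<Rightarrow> 'h) \<Rightarrow> ('h \<Rightarrow> 'h) \<Rightarrow> bool" where
  "proj_le q p \<longleftrightarrow> p \<circ> q = q"

definition mvn_equiv ::
  "('h::chilbert_space \<Rightarrow> 'h) set \<Rightarrow> ('h \<Rightarrow> 'h) \<Rightarrow> ('h \<Rightarrow> 'h) \<Rightarrow> bool" where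
  "mvn_equiv M p q \<longleftrightarrow> (\<exists>v\<in>M. adj v \<circ> v = p \<and> v \<circ> adj v = q)"

definition finite_projection :: "('h::chilbert_space \<Rightarrow> 'h) set \<Rightarrow> ('h \<Rightarrow> 'h) \<Rightarrow> bool" where
  "finite_projection M p \<longleftrightarrow>
     p \<in> projections M \<and> (\<forall>q\<in>projections M. proj_le q p \<and> mvn_equiv M p q \<longrightarrow> q = p)"

definition minimal_projection :: "('h::chilbert_space \<Rightarrow> 'h) set \<Rightarrow> ('h \<Rightarrow> 'h) \<Rightarrow> bool" where
  "minimal_projection M p \<longleftrightarrow>
     p \<in> projections M \<and> p \<noteq> (\<lambda>_. 0) \<and>
     (\<forall>q\<in>projections M. proj_le q p \<longrightarrow> q = (\<lambda>_. 0) \<or> q = p)"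

definition II1_factor :: "('h::chilbert_space \<Rightarrow> 'h) set \<Rightarrow> bool" where
  "II1_factor M \<longleftrightarrow>
     factor M \<and> id \<noteq> (\<lambda>_::'h. 0) \<and> finite_projection M id \<and> (\<nexists>p. minimal_projection M p)"

definition tau :: "'h::chilbert_space \<Rightarrow> ('h \<Rightarrow> 'h) \<Rightarrow> complex" where
  "tau \<Omega> x = cinner \<Omega> (x \<Omega>)"

text \<open>Up to unitary equivalence this is the representation of \<open>M\<close> on \<open>L\<^sup>2(M)\<close>: the Hilbert space
  is the completion of \<open>M\<close> for the inner product \<open>\<tau>(x\<^sup>*y)\<close>, via \<open>x \<mapsto> x\<Omega>\<close>.\<close>

definition acts_standardly :: "('h::chilbert_space \<Rightarrow> 'h) set \<Rightarrow> 'h \<Rightarrow> bool" where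
  "acts_standardly M \<Omega> \<longleftrightarrow>
     norm \<Omega> = 1 \<and>
     (\<forall>x\<in>M. \<forall>y\<in>M. tau \<Omega> (x \<circ> y) = tau \<Omega> (y \<circ> x)) \<and>
     closure ((\<lambda>x. x \<Omega>) ` M) = UNIV \<and>
     (\<forall>x\<in>M. x \<Omega> = 0 \<longrightarrow> x = (\<lambda>_. 0))"


section \<open>\<open>E\<^sub>0\<close>-semigroups and their gauge cocycles\<close>

definition normal_unital_star_endomorphism ::
  "('h::chilbert_space \<Rightarrow> 'h) set \<Rightarrow> (('h \<Rightarrow> 'h) \<Rightarrow> ('h \<Rightarrow> 'h)) \<Rightarrow> bool" where
  "normal_unital_star_endomorphism M \<theta> \<longleftrightarrow>
     \<theta> ` M \<subseteq> M \<and>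
     (\<forall>x\<in>M. \<forall>y\<in>M. \<theta> (\<lambda>v. x v + y v) = (\<lambda>v. \<theta> x v + \<theta> y v)) \<and>
     (\<forall>c. \<forall>x\<in>M. \<theta> (\<lambda>v. c *\<^sub>C x v) = (\<lambda>v. c *\<^sub>C \<theta> x v)) \<and>
     (\<forall>x\<in>M. \<forall>y\<in>M. \<theta> (x \<circ> y) = \<theta> x \<circ> \<theta> y) \<and>
     (\<forall>x\<in>M. \<theta> (adj x) = adj (\<theta> x)) \<and>
     \<theta> id = id \<and>
     (\<forall>\<rho>. in_predual M \<rho> \<longrightarrow> in_predual M (\<lambda>x. \<rho> (\<theta> x)))"

definition E0_semigroup ::
  "('h::chilbert_space \<Rightarrow> 'h) set \<Rightarrow> (real \<Rightarrow> ('h \<Rightarrow> 'h) \<Rightarrow> ('h \<Rightarrow> 'h)) \<Rightarrow> bool" where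
  "E0_semigroup M \<alpha> \<longleftrightarrow>
     (\<forall>t\<ge>0. normal_unital_star_endomorphism M (\<alpha> t)) \<and>
     (\<forall>x\<in>M. \<alpha> 0 x = x) \<and>
     (\<forall>s\<ge>0. \<forall>t\<ge>0. \<forall>x\<in>M. \<alpha> s (\<alpha> t x) = \<alpha> (s + t) x) \<and>
     (\<forall>t>0. \<alpha> t ` M \<noteq> M) \<and>
     (\<forall>x\<in>M. \<forall>\<rho>. in_predual M \<rho> \<longrightarrow> continuous_on {0..} (\<lambda>t. \<rho> (\<alpha> t x)))"

definition cocycle ::
  "('h::chilbert_space \<Rightarrow> 'h) set \<Rightarrow> (real \<Rightarrow> ('h \<Rightarrow> 'h) \<Rightarrow> ('h \<Rightarrow> 'h)) \<Rightarrow>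
    (real \<Rightarrow> 'h \<Rightarrow> 'h) \<Rightarrow> bool" where
  "cocycle M \<alpha> U \<longleftrightarrow>
     (\<forall>t\<ge>0. U t \<in> M \<and> unitary (U t)) \<and>
     (\<forall>v. continuous_on {0..} (\<lambda>t. U t v)) \<and>
     (\<forall>s\<ge>0. \<forall>t\<ge>0. U s \<circ> \<alpha> s (U t) = U (s + t))"

text \<open>A family indexed by \<open>t \<ge> 0\<close> is a function on the reals; extensionality makes such families
  equal as soon as they agree for all \<open>t \<ge> 0\<close>.\<close>

definition gauge_cocycles ::
  "('h::chilbert_space \<Rightarrow> 'h) set \<Rightarrow> (real \<Rightarrow> ('h \<Rightarrow> 'h) \<Rightarrow> ('h \<Rightarrow> 'h)) \<Rightarrow>
    (real \<Rightarrow> 'h \<Rightarrow> 'h) set" where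
  "gauge_cocycles M \<alpha> =
     {U \<in> extensional {0..}. cocycle M \<alpha> U \<and> (\<forall>t\<ge>0. U t \<in> M \<inter> commutant (\<alpha> t ` M))}"

definition c_star ::
  "'h::chilbert_space \<Rightarrow> (real \<Rightarrow> 'h \<Rightarrow> 'h) \<Rightarrow> (real \<Rightarrow> 'h \<Rightarrow> 'h) \<Rightarrow> complex" where
  "c_star \<Omega> U V =
     (THE c. \<forall>t\<ge>0. tau \<Omega> (adj (U t) \<circ> V t) = exp (c * complex_of_real t))"


section \<open>The Hilbert space of the gauge group\<close>

subsection \<open>Quotient by null vectors and completion\<close>

record 'v semi_inner_space =
  vecs :: "'v set"
  vadd :: "'v \<Rightarrow> 'v \<Rightarrow> 'v"
  vscale :: "complex \<Rightarrow> 'v \<Rightarrow> 'v"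
  form :: "'v \<Rightarrow> 'v \<Rightarrow> complex"

definition vdiff :: "'v semi_inner_space \<Rightarrow> 'v \<Rightarrow> 'v \<Rightarrow> 'v" where
  "vdiff E v w = vadd E v (vscale E (-1) w)"

definition vnorm :: "'v semi_inner_space \<Rightarrow> 'v \<Rightarrow> real" where
  "vnorm E v = sqrt (Re (form E v v))"

definition null_rel :: "'v semi_inner_space \<Rightarrow> ('v \<times> 'v) set" where
  "null_rel E = {(v, w). v \<in> vecs E \<and> w \<in> vecs E \<and> form E (vdiff E v w) (vdiff E v w) = 0}"

definition some_rep :: "'v set \<Rightarrow> 'v" where
  "some_rep A = (SOME v. v \<in> A)"

definition null_quotient :: "'v semi_inner_space \<Rightarrow> 'v set semi_inner_space" where
  "null_quotient E =
     \<lparr> vecs = vecs E // null_rel E,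
       vadd = (\<lambda>A B. null_rel E `` {vadd E (some_rep A) (some_rep B)}),
       vscale = (\<lambda>c A. null_rel E `` {vscale E c (some_rep A)}),
       form = (\<lambda>A B. form E (some_rep A) (some_rep B)) \<rparr>"

definition cauchy_sequences :: "'v semi_inner_space \<Rightarrow> (nat \<Rightarrow> 'v) semi_inner_space" where
  "cauchy_sequences E =
     \<lparr> vecs = {X. (\<forall>n. X n \<in> vecs E) \<and>
                  (\<forall>e>0. \<exists>N. \<forall>m\<ge>N. \<forall>n\<ge>N. vnorm E (vdiff E (X m) (X n)) < e)},
       vadd = (\<lambda>X Y n. vadd E (X n) (Y n)),
       vscale = (\<lambda>c X n. vscale E c (X n)),
       form = (\<lambda>X Y. lim (\<lambda>n. form E (X n) (Y n))) \<rparr>"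

text \<open>The null vectors among the Cauchy sequences are exactly the sequences converging to zero, so
  this is the usual completion by Cauchy sequences.\<close>

definition hilbert_completion :: "'v semi_inner_space \<Rightarrow> (nat \<Rightarrow> 'v) set semi_inner_space" where
  "hilbert_completion E = null_quotient (cauchy_sequences E)"


subsection \<open>The space \<open>H(G(\<alpha>))\<close>\<close>

definition supp :: "('g \<Rightarrow> complex) \<Rightarrow> 'g set" where
  "supp f = {U. f U \<noteq> 0}"

text \<open>Functions on \<open>G(\<alpha>)\<close> are extended by zero outside \<open>G(\<alpha>)\<close>.\<close>

definition gauge_prehilbert ::
  "('h::chilbert_space \<Rightarrow> 'h) set \<Rightarrow> 'h \<Rightarrow> (real \<Rightarrow> ('h \<Rightarrow> 'h) \<Rightarrow> ('h \<Rightarrow> 'h)) \<Rightarrow>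
    ((real \<Rightarrow> 'h \<Rightarrow> 'h) \<Rightarrow> complex) semi_inner_space" where
  "gauge_prehilbert M \<Omega> \<alpha> =
     \<lparr> vecs = {f. finite (supp f) \<and> supp f \<subseteq> gauge_cocycles M \<alpha> \<and> (\<Sum>U\<in>supp f. f U) = 0},
       vadd = (\<lambda>f g U. f U + g U),
       vscale = (\<lambda>c f U. c * f U),
       form = (\<lambda>f g. \<Sum>U\<in>supp f. \<Sum>V\<in>supp g. c_star \<Omega> U V * cnj (f U) * g V) \<rparr>"

definition gauge_hilbert where
  "gauge_hilbert M \<Omega> \<alpha> = hilbert_completion (null_quotient (gauge_prehilbert M \<Omega> \<alpha>))"

definition linear_isometry ::
  "'v semi_inner_space \<Rightarrow> ('v \<Rightarrow> 'h::chilbert_space) \<Rightarrow> bool" where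
  "linear_isometry E D \<longleftrightarrow>
     (\<forall>v\<in>vecs E. \<forall>w\<in>vecs E. D (vadd E v w) = D v + D w) \<and>
     (\<forall>c. \<forall>v\<in>vecs E. D (vscale E c v) = c *\<^sub>C D v) \<and>
     (\<forall>v\<in>vecs E. norm (D v) = vnorm E v)"


section \<open>Centred additive cocycles\<close>

definition canonical_unit ::
  "('h::chilbert_space \<Rightarrow> 'h) set \<Rightarrow> 'h \<Rightarrow> (real \<Rightarrow> ('h \<Rightarrow> 'h) \<Rightarrow> ('h \<Rightarrow> 'h)) \<Rightarrow> real \<Rightarrow> 'h \<Rightarrow> 'h" where
  "canonical_unit M \<Omega> \<alpha> t =
     (THE S. S \<in> bounded_ops \<and> (\<forall>v. norm (S v) = norm v) \<and> (\<forall>x\<in>M. S (x \<Omega>) = \<alpha> t x \<Omega>))"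

definition gauge_algebra ::
  "('h::chilbert_space \<Rightarrow> 'h) set \<Rightarrow> (real \<Rightarrow> ('h \<Rightarrow> 'h) \<Rightarrow> ('h \<Rightarrow> 'h)) \<Rightarrow> real \<Rightarrow> ('h \<Rightarrow> 'h) set" where
  "gauge_algebra M \<alpha> t = vn_generated {U s | U s. U \<in> gauge_cocycles M \<alpha> \<and> 0 \<le> s \<and> s \<le> t}"

definition gauge_space ::
  "('h::chilbert_space \<Rightarrow> 'h) set \<Rightarrow> 'h \<Rightarrow> (real \<Rightarrow> ('h \<Rightarrow> 'h) \<Rightarrow> ('h \<Rightarrow> 'h)) \<Rightarrow> real \<Rightarrow> 'h set" where
  "gauge_space M \<Omega> \<alpha> t = closure ((\<lambda>x. x \<Omega>) ` gauge_algebra M \<alpha> t)"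

definition additive_cocycle ::
  "('h::chilbert_space \<Rightarrow> 'h) set \<Rightarrow> 'h \<Rightarrow> (real \<Rightarrow> ('h \<Rightarrow> 'h) \<Rightarrow> ('h \<Rightarrow> 'h)) \<Rightarrow> (real \<Rightarrow> 'h) \<Rightarrow> bool" where
  "additive_cocycle M \<Omega> \<alpha> b \<longleftrightarrow>
     b \<in> borel_measurable (restrict_space borel {0..}) \<and>
     (\<forall>t\<ge>0. b t \<in> gauge_space M \<Omega> \<alpha> t) \<and>
     (\<forall>s\<ge>0. \<forall>t\<ge>0. b (s + t) = b s + canonical_unit M \<Omega> \<alpha> s (b t))"

definition centred_additive_cocycle ::
  "('h::chilbert_space \<Rightarrow> 'h) set \<Rightarrow> 'h \<Rightarrow> (real \<Rightarrow> ('h \<Rightarrow> 'h) \<Rightarrow> ('h \<Rightarrow> 'h)) \<Rightarrow> (real \<Rightarrow> 'h) \<Rightarrow> bool" where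
  "centred_additive_cocycle M \<Omega> \<alpha> b \<longleftrightarrow>
     additive_cocycle M \<Omega> \<alpha> b \<and> (\<forall>t\<ge>0. cinner \<Omega> (b t) = 0)"

end

theory Submission
  imports Defs
begin

text \<open>For gauge cocycles \<open>U\<close>, rescaled to \<open>W\<close> with \<open>\<tau>(W t) = 1\<close>, the additive cocycle attached to \<open>U\<close> is the limit
  of the Riemann sums \<open>\<Sum>i. S (i h) (W h - 1) \<Omega>\<close> over dyadic meshes \<open>h\<close>. Uniqueness of the normal trace on
  a factor gives \<open>\<tau>(p \<alpha>\<^sub>t(z)) = \<tau>(p) \<tau>(z)\<close> for \<open>p\<close> commuting with \<open>\<alpha>\<^sub>t(M)\<close>, which makes the summands orthogonal
  and the correction under halving of the mesh of second order, so the sums converge. Their inner products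
  at time 1 are \<open>2\<^sup>n (exp(2\<^sup>-\<^sup>n k) - 1)\<close>, whose limit \<open>k\<close> is \<open>c\<^sub>*(U,V)\<close> minus a term in \<open>U\<close> alone and a term in \<open>V\<close>
  alone; these two drop out on functions of total weight zero.\<close>

section \<open>Complex Hilbert spaces and bounded operators\<close>

\<comment> \<open>The functional z -> \<tau>(p \<alpha> t (z)) is tracial because p commutes with
  the range of \<alpha> t; this is how the gauge condition enters. As a result the vectors x
  \<alpha> t (y) \<Omega> multiply like elementary tensors, and inner products of cocycles are
  multiplicative in t, hence exponential. Normalising the trace to 1 makes the increment (W h - 1)
  \<Omega> orthogonal to \<Omega>, and then, by the product formula, to the whole range of S h. An
  increment has norm of order sqrt h. Halving the mesh produces about t / h corrections, each of
  norm of order h: the triangle inequality would only bound their sum by order 1, but they are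
  mutually orthogonal, so the sum is of order sqrt h, which is geometric along dyadic meshes.
  Rounding of t to the mesh costs at most one further increment, again of order sqrt h. For
  H(G(\<alpha>)), writing the form as an inner product of vectors of L2(M) yields at once its
  positivity and the compatibility with quotient and completion.\<close>
subclass (in chilbert_space) banach ..

lemma cscale_one [simp]: "1 *\<^sub>C x = (x::'a::chilbert_space)"
  using cscale_of_real[of 1 x] by simp

lemma cscale_zero_left [simp]: "0 *\<^sub>C x = (0::'a::chilbert_space)"
  using cscale_of_real[of 0 x] by simp

lemma cscale_zero_right [simp]: "c *\<^sub>C 0 = (0::'a::chilbert_space)"
  using cscale_add_right[of c "0::'a" 0] by simp

lemma cscale_minus_left: "(- c) *\<^sub>C x = - (c *\<^sub>C (x::'a::chilbert_space))"
  using cscale_add_left[of c "- c" x] by (simp add: eq_neg_iff_add_eq_0 add.commute)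

lemma cscale_minus_right: "c *\<^sub>C (- x) = - (c *\<^sub>C (x::'a::chilbert_space))"
  using cscale_add_right[of c x "- x"] by (simp add: eq_neg_iff_add_eq_0 add.commute)

lemma cscale_diff_left: "(c - d) *\<^sub>C x = c *\<^sub>C x - d *\<^sub>C (x::'a::chilbert_space)"
  using cscale_add_left[of c "- d" x] by (simp add: cscale_minus_left)

lemma cscale_sum_right: "c *\<^sub>C (\<Sum>i\<in>A. f i) = (\<Sum>i\<in>A. c *\<^sub>C (f i :: 'a::chilbert_space))"
  by (induction A rule: infinite_finite_induct) (simp_all add: cscale_add_right)

lemma cinner_add_left: "cinner (x + y) z = cinner x z + cinner y (z::'a::chilbert_space)"
  by (metis cinner_add_right cinner_commute complex_cnj_add)

lemma cinner_cscale_left: "cinner (c *\<^sub>C x) y = cnj c * cinner x (y::'a::chilbert_space)"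
  by (metis cinner_cscale_right cinner_commute complex_cnj_mult)

lemma cinner_zero_right [simp]: "cinner x (0::'a::chilbert_space) = 0"
  using cinner_cscale_right[of x 0 0] by simp

lemma cinner_zero_left [simp]: "cinner (0::'a::chilbert_space) x = 0"
  using cinner_cscale_left[of 0 0 x] by simp

lemma cinner_minus_right: "cinner x (- y) = - cinner x (y::'a::chilbert_space)"
  using cinner_add_right[of x y "- y"] by (simp add: eq_neg_iff_add_eq_0 add.commute)

lemma cinner_minus_left: "cinner (- x) y = - cinner x (y::'a::chilbert_space)"
  using cinner_add_left[of x "- x" y] by (simp add: eq_neg_iff_add_eq_0 add.commute)

lemma cinner_diff_right: "cinner x (y - z) = cinner x y - cinner x (z::'a::chilbert_space)"
  using cinner_add_right[of x y "- z"] by (simp add: cinner_minus_right)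

lemma cinner_diff_left: "cinner (x - y) z = cinner x z - cinner y (z::'a::chilbert_space)"
  using cinner_add_left[of x "- y" z] by (simp add: cinner_minus_left)

lemma cinner_sum_right: "cinner x (\<Sum>i\<in>A. f i) = (\<Sum>i\<in>A. cinner x (f i :: 'a::chilbert_space))"
  by (induction A rule: infinite_finite_induct) (simp_all add: cinner_add_right)

lemma cinner_sum_left: "cinner (\<Sum>i\<in>A. f i) x = (\<Sum>i\<in>A. cinner (f i :: 'a::chilbert_space) x)"
  by (induction A rule: infinite_finite_induct) (simp_all add: cinner_add_left)

lemmas cinner_simps = cinner_add_left cinner_add_right cinner_diff_left cinner_diff_right
  cinner_cscale_left cinner_cscale_right

lemma norm_cscale: "norm (c *\<^sub>C x) = cmod c * norm (x::'a::chilbert_space)"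
proof -
  have "complex_of_real ((norm (c *\<^sub>C x))\<^sup>2) = c * cnj c * cinner x x"
    unfolding cinner_self[symmetric] by (simp add: cinner_simps)
  also have "\<dots> = complex_of_real ((cmod c * norm x)\<^sup>2)"
    by (simp only: cinner_self power_mult_distrib complex_norm_square of_real_mult)
  finally show ?thesis
    by (simp only: of_real_eq_iff) (simp add: power2_eq_iff_nonneg)
qed

lemma cinner_eq_zero_iff: "cinner x x = 0 \<longleftrightarrow> (x::'a::chilbert_space) = 0"
  by (simp add: cinner_self)

lemma cinner_extI: "(\<And>w. cinner w x = cinner w y) \<Longrightarrow> x = (y::'a::chilbert_space)"
  using cinner_eq_zero_iff[of "x - y"] by (simp add: cinner_diff_right)

text \<open>The imaginary part is a real inner product with a rotated vector. Continuity, existence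
  of adjoints and preservation of inner products by isometries are therefore proved for
  \<open>inner\<close> only.\<close>

lemma cinner_eq_Complex: "cinner x y = Complex (inner x y) (- inner x (\<i> *\<^sub>C (y::'a::chilbert_space)))"
  by (simp add: complex_eq_iff inner_eq_Re_cinner cinner_simps)

lemma tendsto_cscale [tendsto_intros]:
  "(f \<longlongrightarrow> x) F \<Longrightarrow> ((\<lambda>i. c *\<^sub>C f i) \<longlongrightarrow> c *\<^sub>C (x::'a::chilbert_space)) F"
proof -
  have "bounded_linear (\<lambda>x::'a. c *\<^sub>C x)"
    by (rule bounded_linear_intro[where K = "cmod c"])
       (simp_all add: cscale_add_right norm_cscale mult.commute cscale_cscale
          flip: cscale_of_real)
  then show "(f \<longlongrightarrow> x) F \<Longrightarrow> ?thesis"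
    by (rule bounded_linear.tendsto)
qed

lemma tendsto_cinner [tendsto_intros]:
  "(f \<longlongrightarrow> x) F \<Longrightarrow> (g \<longlongrightarrow> y) F \<Longrightarrow>
    ((\<lambda>i. cinner (f i) (g i)) \<longlongrightarrow> cinner x (y::'a::chilbert_space)) F"
  unfolding cinner_eq_Complex by (intro tendsto_intros)

lemma continuous_on_cinner [continuous_intros]:
  "continuous_on A f \<Longrightarrow> continuous_on A g \<Longrightarrow>
    continuous_on A (\<lambda>i. cinner (f i) (g i :: 'a::chilbert_space))"
  unfolding continuous_on_def by (auto intro: tendsto_intros)

lemma continuous_on_cscale [continuous_intros]:
  "continuous_on A f \<Longrightarrow> continuous_on A (\<lambda>i. c *\<^sub>C (f i :: 'a::chilbert_space))"
  unfolding continuous_on_def by (auto intro: tendsto_intros)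

lemma cmod_cinner_le: "cmod (cinner x y) \<le> norm x * norm (y::'a::chilbert_space)"
proof (cases "cinner x y = 0")
  case False
  \<comment> \<open>The phase that rotates \<open>cinner x y\<close> onto the nonnegative real axis,
    where the real Cauchy-Schwarz inequality applies to \<open>z *\<^sub>C y\<close>.\<close>
  define z where "z = cnj (cinner x y) / cmod (cinner x y)"
  have "cmod z = 1"
    using False by (simp add: z_def norm_divide)
  have "z * cinner x y = cmod (cinner x y)"
    using False by (simp add: z_def complex_norm_square[symmetric] power2_eq_square mult.commute)
  then have "cmod (cinner x y) = inner x (z *\<^sub>C y)"
    by (simp add: inner_eq_Re_cinner cinner_simps)
  also have "\<dots> \<le> norm x * norm y"
    using norm_cauchy_schwarz[of x "z *\<^sub>C y"] \<open>cmod z = 1\<close> by (simp add: norm_cscale)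
  finally show ?thesis .
qed simp

lemma closure_UNIV_induct:
  assumes "closure D = UNIV" "closed {v. P v}" "\<And>v. v \<in> D \<Longrightarrow> P v"
  shows "P v"
  using closure_minimal[of D "{v. P v}"] assms by auto

section \<open>Bounded complex-linear operators\<close>

lemma bounded_opsI:
  assumes "\<And>x y. T (x + y) = T x + T y" "\<And>c x. T (c *\<^sub>C x) = c *\<^sub>C T x"
    and "\<And>x. norm (T x) \<le> K * norm x"
  shows "T \<in> bounded_ops"
proof -
  have "bounded_linear T"
    by (rule bounded_linear_intro[where K = K])
       (use assms in \<open>simp_all add: mult.commute flip: cscale_of_real\<close>)
  with assms show ?thesis
    by (simp add: bounded_ops_def Vector_Spaces.linear_iff vector_space_cscale)
qed

lemma bounded_opsD:
  assumes "T \<in> bounded_ops"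
  shows bounded_ops_add: "T (x + y) = T x + T y"
    and bounded_ops_cscale: "T (c *\<^sub>C x) = c *\<^sub>C T x"
    and bounded_ops_zero: "T 0 = 0"
    and bounded_ops_diff: "T (x - y) = T x - T y"
    and bounded_ops_linear: "bounded_linear T"
proof -
  show lin: "bounded_linear T"
    using assms by (simp add: bounded_ops_def)
  show "T (x + y) = T x + T y" "T (c *\<^sub>C x) = c *\<^sub>C T x"
    using assms by (simp_all add: bounded_ops_def Vector_Spaces.linear_iff)
  show "T 0 = 0" "T (x - y) = T x - T y"
    using lin by (simp_all add: linear_simps)
qed

lemma bounded_ops_bound:
  assumes "T \<in> bounded_ops"
  obtains K where "K \<ge> 0" "\<And>v. norm (T v) \<le> K * norm v"
  using bounded_linear.nonneg_bounded[OF bounded_ops_linear[OF assms]] by (metis mult.commute)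

lemma bounded_ops_tendsto:
  "T \<in> bounded_ops \<Longrightarrow> (f \<longlongrightarrow> x) F \<Longrightarrow> ((\<lambda>i. T (f i)) \<longlongrightarrow> T x) F"
  by (rule bounded_linear.tendsto[OF bounded_ops_linear])

lemma bounded_ops_continuous_on: "T \<in> bounded_ops \<Longrightarrow> continuous_on A T"
  using bounded_ops_linear linear_continuous_on by blast

lemma id_bounded_ops [simp]: "id \<in> bounded_ops" "(\<lambda>x. x) \<in> bounded_ops"
  by (rule bounded_opsI[where K = 1]; simp)+

lemma bounded_ops_closed_add:
  assumes "T \<in> bounded_ops" "S \<in> bounded_ops"
  shows "(\<lambda>v. T v + S v) \<in> bounded_ops"
proof -
  obtain K L where "\<And>v. norm (T v) \<le> K * norm v" "\<And>v. norm (S v) \<le> L * norm v"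
    using assms by (metis bounded_ops_bound)
  then have "norm (T v + S v) \<le> (K + L) * norm v" for v
    by (metis norm_triangle_mono distrib_right)
  then show ?thesis
    by (intro bounded_opsI[where K = "K + L"])
       (simp_all add: bounded_opsD[OF assms(1)] bounded_opsD[OF assms(2)] cscale_add_right)
qed

lemma bounded_ops_closed_cscale:
  assumes "T \<in> bounded_ops"
  shows "(\<lambda>v. c *\<^sub>C T v) \<in> bounded_ops"
proof -
  obtain K where "\<And>v. norm (T v) \<le> K * norm v"
    using assms by (metis bounded_ops_bound)
  then have "norm (c *\<^sub>C T v) \<le> (cmod c * K) * norm v" for v
    by (simp add: norm_cscale mult.assoc mult_left_mono)
  then show ?thesis
    by (intro bounded_opsI[where K = "cmod c * K"])
       (simp_all add: bounded_opsD[OF assms(1)] cscale_add_right cscale_cscale mult.commute)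
qed

lemma bounded_ops_closed_comp:
  assumes "T \<in> bounded_ops" "S \<in> bounded_ops"
  shows "T \<circ> S \<in> bounded_ops"
proof -
  obtain K L where *: "K \<ge> 0" "\<And>v. norm (T v) \<le> K * norm v" "\<And>v. norm (S v) \<le> L * norm v"
    using assms by (metis bounded_ops_bound)
  have "norm (T (S v)) \<le> (K * L) * norm v" for v
    using order_trans[OF *(2) mult_left_mono[OF *(3) *(1)]] by (simp add: mult.assoc)
  then show ?thesis
    by (intro bounded_opsI[where K = "K * L"])
       (simp_all add: bounded_opsD[OF assms(1)] bounded_opsD[OF assms(2)])
qed

lemma bounded_ops_eqI:
  assumes "T \<in> bounded_ops" "S \<in> bounded_ops" "closure D = UNIV" "\<And>v. v \<in> D \<Longrightarrow> T v = S v"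
  shows "T = S"
proof
  fix v
  show "T v = S v"
    by (rule closure_UNIV_induct[OF assms(3)])
       (auto intro!: closed_Collect_eq bounded_ops_continuous_on assms)
qed

subsection \<open>Minimal vectors and adjoints\<close>

text \<open>By the parallelogram law a minimizing sequence is Cauchy. The last conclusion, that the
  minimizer is the only element of its norm, later yields invariance under norm-preserving
  symmetries of \<open>C\<close>.\<close>

lemma convex_min_norm:
  fixes C :: "'a::{real_inner,complete_space} set"
  assumes "closed C" "convex C" "C \<noteq> {}"
  obtains x where "x \<in> C" "\<And>y. y \<in> C \<Longrightarrow> norm x \<le> norm y"
    "\<And>y. y \<in> C \<Longrightarrow> norm y = norm x \<Longrightarrow> y = x"
proof -
  define d where "d = (INF y\<in>C. norm y)"
  have bdd: "bdd_below (norm ` C)"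
    by (rule bdd_belowI[of _ 0]) auto
  have d_le: "d \<le> norm y" if "y \<in> C" for y
    unfolding d_def using that bdd by (rule cINF_lower[rotated])
  have "d \<ge> 0"
    unfolding d_def using assms(3) by (rule cINF_greatest) simp
  \<comment> \<open>Parallelogram law; the midpoint of \<open>x\<close> and \<open>y\<close> is in
    \<open>C\<close> and so has norm at least \<open>d\<close>.\<close>
  have mid: "(norm (x - y))\<^sup>2 \<le> 2 * (norm x)\<^sup>2 + 2 * (norm y)\<^sup>2 - 4 * d\<^sup>2"
    if "x \<in> C" "y \<in> C" for x y
  proof -
    have "(1/2) *\<^sub>R x + (1/2) *\<^sub>R y \<in> C"
      using that assms(2) by (intro convexD) auto
    then have "d \<le> norm ((1/2) *\<^sub>R (x + y))"
      using d_le by (metis scaleR_right_distrib)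
    then have "2 * d \<le> norm (x + y)"
      by simp
    then have "(2 * d)\<^sup>2 \<le> (norm (x + y))\<^sup>2"
      using \<open>d \<ge> 0\<close> by (intro power_mono) auto
    then show ?thesis
      by (simp add: power2_norm_eq_inner power_mult_distrib inner_simps inner_commute)
  qed
  have "\<exists>y\<in>C. norm y < d + 1 / Suc n" for n
    using cINF_less_iff[OF assms(3) bdd, of "d + 1 / Suc n"] by (simp add: d_def)
  then obtain y where y: "\<And>n. y n \<in> C" "\<And>n. norm (y n) < d + 1 / Suc n"
    by metis
  have "(\<lambda>n. norm (y n)) \<longlonglongrightarrow> d"
  proof (rule tendsto_sandwich[of "\<lambda>_. d" _ _ "\<lambda>n. d + 1 / Suc n"])
    show "(\<lambda>n. d + 1 / Suc n) \<longlonglongrightarrow> d"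
      using LIMSEQ_inverse_real_of_nat_add[of d] by (simp add: inverse_eq_divide)
    show "\<forall>\<^sub>F n in sequentially. norm (y n) \<le> d + 1 / Suc n"
      by (intro always_eventually allI less_imp_le y)
  qed (use y d_le in auto)
  have "Cauchy y"
  proof (rule metric_CauchyI)
    fix e :: real assume "e > 0"
    have "(\<lambda>n. (norm (y n))\<^sup>2) \<longlonglongrightarrow> d\<^sup>2"
      by (intro tendsto_intros) fact
    then have "\<forall>\<^sub>F n in sequentially. (norm (y n))\<^sup>2 < d\<^sup>2 + e\<^sup>2 / 4"
      using \<open>e > 0\<close> by (intro order_tendstoD) auto
    then obtain N where N: "\<And>n. n \<ge> N \<Longrightarrow> (norm (y n))\<^sup>2 < d\<^sup>2 + e\<^sup>2 / 4"
      by (auto simp: eventually_sequentially)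
    have "dist (y m) (y n) < e" if "m \<ge> N" "n \<ge> N" for m n
    proof -
      have "(norm (y m - y n))\<^sup>2 < e\<^sup>2"
        using mid[OF y(1)[of m] y(1)[of n]] N[OF that(1)] N[OF that(2)] by simp
      then show ?thesis
        using \<open>e > 0\<close> by (simp add: dist_norm power2_less_imp_less)
    qed
    then show "\<exists>N. \<forall>m\<ge>N. \<forall>n\<ge>N. dist (y m) (y n) < e"
      by blast
  qed
  then obtain x where x: "y \<longlonglongrightarrow> x"
    using Cauchy_convergent convergent_def by blast
  have "x \<in> C"
    using assms(1) y(1) x by (meson closed_sequentially)
  moreover have "norm x = d"
    using LIMSEQ_unique[OF tendsto_norm[OF x]] \<open>(\<lambda>n. norm (y n)) \<longlonglongrightarrow> d\<close> by blast
  moreover have "z = x" if "z \<in> C" "norm z = norm x" for z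
    using mid[OF that(1) \<open>x \<in> C\<close>] that \<open>norm x = d\<close> by simp
  ultimately show thesis
    using that d_le by blast
qed

text \<open>The representing vector is a multiple of the shortest vector \<open>z\<close> of the
  hyperplane where \<open>f\<close> is 1; minimality makes \<open>z\<close> orthogonal to the kernel
  of \<open>f\<close>.\<close>

lemma Riesz_representation:
  fixes f :: "'a::{real_inner,complete_space} \<Rightarrow> real"
  assumes "bounded_linear f"
  obtains z where "\<And>x. f x = inner z x"
proof (cases "\<forall>x. f x = 0")
  case True
  then show thesis using that[of 0] by simp
next
  case False
  interpret f: bounded_linear f by fact
  define C where "C = {x. f x = 1}"
  have "closed C"
    unfolding C_def by (intro closed_Collect_eq continuous_intros linear_continuous_on assms)
  moreover have "convex C"
    unfolding C_def by (auto simp: convex_def f.add f.scaleR)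
  moreover obtain x0 where "f x0 \<noteq> 0" using False by blast
  then have "(1 / f x0) *\<^sub>R x0 \<in> C"
    by (simp add: C_def f.scaleR)
  then have "C \<noteq> {}" by blast
  ultimately obtain z where z: "z \<in> C" "\<And>y. y \<in> C \<Longrightarrow> norm z \<le> norm y"
    using convex_min_norm by metis
  have "z \<noteq> 0"
    using z(1) by (auto simp: C_def f.zero)
  have orth: "inner z k = 0" if "f k = 0" for k
  proof -
    \<comment> \<open>The minimizer over \<open>r\<close> of the norm of
      \<open>z + r *\<^sub>R k\<close>, if \<open>k\<close> is nonzero.\<close>
    define r where "r = - inner z k / inner k k"
    have "z + r *\<^sub>R k \<in> C"
      using z(1) that by (simp add: C_def f.add f.scaleR)
    then have "(norm z)\<^sup>2 \<le> (norm (z + r *\<^sub>R k))\<^sup>2"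
      using z(2) by (intro power_mono) auto
    also have "\<dots> = (norm z)\<^sup>2 + 2 * r * inner z k + r\<^sup>2 * inner k k"
      by (simp only: power2_norm_eq_inner) (simp add: inner_simps inner_commute power2_eq_square)
    finally have "0 \<le> - (inner z k)\<^sup>2 / inner k k"
      by (cases "inner k k = 0") (simp_all add: r_def power2_eq_square)
    then show ?thesis
      by (cases "k = 0") (auto simp: divide_le_0_iff dest: antisym)
  qed
  have "f x = inner ((1 / inner z z) *\<^sub>R z) x" for x
  proof -
    have "f (x - f x *\<^sub>R z) = 0"
      using z(1) by (simp add: C_def f.diff f.scaleR)
    then have "inner z x = f x * inner z z"
      using orth[of "x - f x *\<^sub>R z"] by (simp add: inner_simps)
    then show ?thesis
      using \<open>z \<noteq> 0\<close> by simp
  qed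
  then show thesis using that by blast
qed

text \<open>Riesz for the real part determines the complex inner product as well, since
  \<open>T\<close> commutes with multiplication by \<i>. The bound on \<open>S\<close> comes from
  pairing \<open>S x\<close> with itself.\<close>

lemma adj_exists:
  fixes T :: "'h::chilbert_space \<Rightarrow> 'h"
  assumes "T \<in> bounded_ops"
  shows "\<exists>S\<in>bounded_ops. \<forall>x y. cinner (S x) y = cinner x (T y)"
proof -
  obtain K where K: "K \<ge> 0" "\<And>v. norm (T v) \<le> K * norm v"
    using assms by (metis bounded_ops_bound)
  have "\<exists>z. \<forall>y. cinner z y = cinner x (T y)" for x
  proof -
    have "bounded_linear (\<lambda>y. inner x (T y))"
      using bounded_linear_compose[OF bounded_linear_inner_right bounded_ops_linear[OF assms]]
      by (simp add: o_def)
    then obtain z where z: "\<And>y. inner x (T y) = inner z y"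
      using Riesz_representation by metis
    have "cinner z y = cinner x (T y)" for y
      unfolding cinner_eq_Complex z[symmetric] by (simp add: bounded_opsD[OF assms])
    then show ?thesis by blast
  qed
  then obtain S where S: "\<And>x y. cinner (S x) y = cinner x (T y)"
    by metis
  have eqI: "x = y" if "\<And>w. cinner x w = cinner y w" for x y :: 'h
    using that cinner_extI by (metis cinner_commute)
  have "S \<in> bounded_ops"
  proof (rule bounded_opsI)
    show "S (x + y) = S x + S y" "S (c *\<^sub>C x) = c *\<^sub>C S x" for x y c
      by (rule eqI, simp add: S cinner_simps)+
    show "norm (S x) \<le> K * norm x" for x
    proof -
      have "(norm (S x))\<^sup>2 = cmod (cinner (S x) (S x))"
        by (simp add: cinner_self norm_power)
      also have "\<dots> \<le> norm x * norm (T (S x))"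
        unfolding S by (rule cmod_cinner_le)
      also have "\<dots> \<le> norm x * (K * norm (S x))"
        by (intro mult_left_mono K norm_ge_zero)
      finally have "norm (S x) * norm (S x) \<le> norm (S x) * (K * norm x)"
        by (simp add: power2_eq_square mult_ac)
      then show ?thesis
        using K(1) by (cases "S x = 0") auto
    qed
  qed
  with S show ?thesis by blast
qed

lemma adj_unique:
  fixes T :: "'h::chilbert_space \<Rightarrow> 'h"
  assumes "S \<in> bounded_ops" "\<And>x y. cinner (S x) y = cinner x (T y)"
  shows "adj T = S"
  unfolding adj_def
proof (rule the_equality)
  fix R assume R: "R \<in> bounded_ops \<and> (\<forall>x y. cinner (R x) y = cinner x (T y))"
  show "R = S"
  proof
    fix x
    show "R x = S x"
      by (rule cinner_extI, subst (1 2) cinner_commute) (simp add: R assms)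
  qed
qed (use assms in blast)

lemma
  fixes T :: "'h::chilbert_space \<Rightarrow> 'h"
  assumes "T \<in> bounded_ops"
  shows adj_bounded_ops: "adj T \<in> bounded_ops"
    and cinner_adj_left: "cinner (adj T x) y = cinner x (T y)"
    and cinner_adj_right: "cinner x (adj T y) = cinner (T x) y"
proof -
  obtain S where S: "S \<in> bounded_ops" "\<And>x y. cinner (S x) y = cinner x (T y)"
    using adj_exists[OF assms] by blast
  then have "adj T = S"
    by (rule adj_unique)
  with S show "adj T \<in> bounded_ops" and *: "cinner (adj T x) y = cinner x (T y)" for x y
    by simp_all
  show "cinner x (adj T y) = cinner (T x) y"
    using *[of y x] by (metis cinner_commute)
qed

lemma adj_adj: "T \<in> bounded_ops \<Longrightarrow> adj (adj T) = T"
  by (rule adj_unique) (simp_all add: cinner_adj_right)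

lemma adj_comp:
  assumes "T \<in> bounded_ops" "S \<in> bounded_ops"
  shows "adj (T \<circ> S) = adj S \<circ> adj T"
  by (rule adj_unique) (simp_all add: assms bounded_ops_closed_comp adj_bounded_ops cinner_adj_left)

lemma adj_id: "adj id = id"
  by (rule adj_unique) simp_all

section \<open>Von Neumann algebras with a tracial vector\<close>

lemma commutantD: "T \<in> commutant A \<Longrightarrow> S \<in> A \<Longrightarrow> T (S v) = S (T v)"
  unfolding commutant_def by (auto simp: fun_eq_iff)

lemma commutantI:
  "T \<in> bounded_ops \<Longrightarrow> (\<And>S v. S \<in> A \<Longrightarrow> T (S v) = S (T v)) \<Longrightarrow> T \<in> commutant A"
  unfolding commutant_def by (auto simp: fun_eq_iff)

lemma commutant_bounded_ops: "T \<in> commutant A \<Longrightarrow> T \<in> bounded_ops"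
  by (simp add: commutant_def)

lemma commutant_id: "A \<subseteq> bounded_ops \<Longrightarrow> id \<in> commutant A"
  by (rule commutantI) simp_all

lemma commutant_add:
  assumes "A \<subseteq> bounded_ops" "T \<in> commutant A" "S \<in> commutant A"
  shows "(\<lambda>v. T v + S v) \<in> commutant A"
  using assms
  by (intro commutantI bounded_ops_closed_add)
     (auto simp: commutant_bounded_ops commutantD bounded_ops_add subset_iff)

lemma commutant_cscale:
  assumes "A \<subseteq> bounded_ops" "T \<in> commutant A"
  shows "(\<lambda>v. c *\<^sub>C T v) \<in> commutant A"
  using assms
  by (intro commutantI bounded_ops_closed_cscale)
     (auto simp: commutant_bounded_ops commutantD bounded_ops_cscale subset_iff)

lemma commutant_comp:
  assumes "T \<in> commutant A" "S \<in> commutant A"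
  shows "T \<circ> S \<in> commutant A"
  using assms
  by (intro commutantI bounded_ops_closed_comp) (auto simp: commutant_bounded_ops commutantD)

lemma commutant_adj:
  assumes "A \<subseteq> bounded_ops" "\<And>x. x \<in> A \<Longrightarrow> adj x \<in> A" "T \<in> commutant A"
  shows "adj T \<in> commutant A"
proof (rule commutantI)
  show T: "adj T \<in> bounded_ops"
    using assms(3) by (simp add: adj_bounded_ops commutant_bounded_ops)
  fix S v assume S: "S \<in> A"
  have S': "S \<in> bounded_ops"
    using S assms(1) by blast
  show "adj T (S v) = S (adj T v)"
  proof (rule cinner_extI)
    fix w
    have "cinner w (adj T (S v)) = cinner (adj S (T w)) v"
      using S' assms(3) by (simp add: cinner_adj_right cinner_adj_left commutant_bounded_ops)
    also have "\<dots> = cinner (T (adj S w)) v"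
      using commutantD[OF assms(3) assms(2)[OF S]] by simp
    also have "\<dots> = cinner w (S (adj T v))"
      using S' assms(3) by (simp add: cinner_adj_left commutant_bounded_ops flip: cinner_adj_right)
    finally show "cinner w (adj T (S v)) = cinner w (S (adj T v))" .
  qed
qed

text \<open>A commutant of bounded operators is a unital algebra, and \<open>N\<close> is the
  commutant of its own commutant. The rule \<open>vnI\<close> is the form in which inverses and
  strong limits are shown to stay in \<open>N\<close>.\<close>

lemma von_neumann_algebraD:
  assumes N: "von_neumann_algebra N"
  shows vn_bounded_ops: "T \<in> N \<Longrightarrow> T \<in> bounded_ops"
    and vn_id: "id \<in> N"
    and vn_add: "T \<in> N \<Longrightarrow> S \<in> N \<Longrightarrow> (\<lambda>v. T v + S v) \<in> N"
    and vn_cscale: "T \<in> N \<Longrightarrow> (\<lambda>v. c *\<^sub>C T v) \<in> N"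
    and vn_comp: "T \<in> N \<Longrightarrow> S \<in> N \<Longrightarrow> T \<circ> S \<in> N"
    and vn_adj: "T \<in> N \<Longrightarrow> adj T \<in> N"
    and vnI: "T \<in> bounded_ops \<Longrightarrow> (\<And>S v. S \<in> commutant N \<Longrightarrow> T (S v) = S (T v)) \<Longrightarrow> T \<in> N"
proof -
  have eq: "commutant (commutant N) = N"
    using N by (simp add: von_neumann_algebra_def)
  have sub: "commutant N \<subseteq> bounded_ops"
    by (auto simp: commutant_bounded_ops)
  show "T \<in> N \<Longrightarrow> T \<in> bounded_ops" "T \<in> N \<Longrightarrow> adj T \<in> N"
    using N by (auto simp: von_neumann_algebra_def)
  show "id \<in> N"
    using commutant_id[OF sub] eq by simp
  show "T \<in> N \<Longrightarrow> S \<in> N \<Longrightarrow> (\<lambda>v. T v + S v) \<in> N"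
    using commutant_add[OF sub] eq by simp
  show "T \<in> N \<Longrightarrow> (\<lambda>v. c *\<^sub>C T v) \<in> N"
    using commutant_cscale[OF sub] eq by simp
  show "T \<in> N \<Longrightarrow> S \<in> N \<Longrightarrow> T \<circ> S \<in> N"
    using commutant_comp[of T "commutant N" S] eq by simp
  show "T \<in> bounded_ops \<Longrightarrow> (\<And>S v. S \<in> commutant N \<Longrightarrow> T (S v) = S (T v)) \<Longrightarrow> T \<in> N"
    using commutantI[of T "commutant N"] eq by simp
qed

lemma vn_diff:
  assumes "von_neumann_algebra N" "T \<in> N" "S \<in> N"
  shows "(\<lambda>v. T v - S v) \<in> N"
  using vn_add[OF assms(1,2) vn_cscale[OF assms(1,3), of "-1"]] by (simp add: cscale_minus_left)

subsection \<open>Unitaries and the commutant\<close>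

text \<open>Solving \<open>w + b w = v\<close> is a fixed-point problem for a contraction of ratio
  1/2, which gives the inverse without summing a Neumann series.\<close>

lemma inverse_one_plus_small:
  fixes b :: "'h::chilbert_space \<Rightarrow> 'h"
  assumes b: "b \<in> bounded_ops" and small: "\<And>v. norm (b v) \<le> 1/2 * norm v"
  obtains R where "R \<in> bounded_ops" "\<And>v. R v + b (R v) = v" "\<And>v. R (v + b v) = v"
proof -
  note b_simps = bounded_opsD[OF b]
  have "\<exists>w. w + b w = v" for v
  proof -
    have "\<exists>!w. v - b w = w"
    proof (rule banach_fix_type)
      show "\<forall>x y. dist (v - b x) (v - b y) \<le> 1/2 * dist x y"
        using small[of "y - x" for x y]
        by (simp add: dist_norm norm_minus_commute bounded_ops_diff[OF b])
    qed simp_all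
    then obtain w where "v - b w = w" by blast
    then show ?thesis by (metis diff_add_cancel)
  qed
  then obtain R where R: "\<And>v. R v + b (R v) = v"
    by metis
  have inj: "x = y" if "x + b x = y + b y" for x y
  proof -
    have "b (y - x) = - (y - x)"
      using that by (simp add: b_simps algebra_simps)
    then show ?thesis
      using small[of "y - x"] by (simp add: norm_minus_commute)
  qed
  have "R \<in> bounded_ops"
  proof (rule bounded_opsI)
    show "R (x + y) = R x + R y" for x y
    proof (rule inj)
      have "R x + R y + b (R x + R y) = (R x + b (R x)) + (R y + b (R y))"
        by (simp add: b_simps)
      then show "R (x + y) + b (R (x + y)) = R x + R y + b (R x + R y)"
        by (simp add: R)
    qed
    show "R (c *\<^sub>C x) = c *\<^sub>C R x" for c x
    proof (rule inj)
      have "c *\<^sub>C R x + b (c *\<^sub>C R x) = c *\<^sub>C (R x + b (R x))"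
        by (simp add: b_simps cscale_add_right)
      then show "R (c *\<^sub>C x) + b (R (c *\<^sub>C x)) = c *\<^sub>C R x + b (c *\<^sub>C R x)"
        by (simp add: R)
    qed
    show "norm (R x) \<le> 2 * norm x" for x
    proof -
      have "R x = x - b (R x)"
        using R[of x] by (simp add: eq_diff_eq)
      then have "norm (R x) = norm (x - b (R x))"
        by (rule arg_cong)
      also have "\<dots> \<le> norm x + norm (b (R x))"
        by (rule norm_triangle_ineq4)
      finally show ?thesis
        using small[of "R x"] by simp
    qed
  qed
  moreover have "R (v + b v) = v" for v
    by (rule inj) (rule R)
  ultimately show thesis
    using that R by blast
qed

text \<open>The unitary is the Cayley transform \<open>u = (1 - b)(1 + b)\<^sup>-\<^sup>1 = 2(1 + b)\<^sup>-\<^sup>1 - 1\<close>, from which \<open>b\<close> can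
  be recovered.\<close>

lemma commutes_skew_if_commutes_unitaries:
  fixes M :: "('h::chilbert_space \<Rightarrow> 'h) set"
  assumes M: "von_neumann_algebra M"
    and y: "y \<in> bounded_ops" "\<And>u v. u \<in> M \<Longrightarrow> unitary u \<Longrightarrow> y (u v) = u (y v)"
    and b: "b \<in> M" "\<And>p q. cinner (b p) q = - cinner p (b q)"
    and small: "\<And>v. norm (b v) \<le> 1/2 * norm v"
  shows "y (b v) = b (y v)"
proof -
  have b': "b \<in> bounded_ops"
    using M b(1) by (rule vn_bounded_ops)
  obtain R where R: "R \<in> bounded_ops" "\<And>v. R v + b (R v) = v" "\<And>v. R (v + b v) = v"
    using inverse_one_plus_small[OF b' small] by blast
  have "(\<lambda>v. - b v) \<in> bounded_ops"
    using bounded_ops_closed_cscale[OF b', of "-1"] by (simp add: cscale_minus_left)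
  then obtain R' where R': "R' \<in> bounded_ops" "\<And>v. R' v - b (R' v) = v" "\<And>v. R' (v - b v) = v"
    using inverse_one_plus_small[of "\<lambda>v. - b v"] small by auto
  \<comment> \<open>Whatever commutes with \<open>b\<close> commutes with the inverse of
    \<open>1 + b\<close>, so \<open>R\<close> lies in the double commutant.\<close>
  have "R \<in> M"
  proof (rule vnI[OF M R(1)])
    fix S v assume S: "S \<in> commutant M"
    have "S v = S (R v + b (R v))"
      by (simp add: R)
    also have "\<dots> = S (R v) + b (S (R v))"
      using S b(1) by (simp add: bounded_ops_add[OF commutant_bounded_ops[OF S]] commutantD[OF S])
    finally have "R (S v) = R (S (R v) + b (S (R v)))"
      by simp
    then show "R (S v) = S (R v)"
      by (simp add: R(3))
  qed
  define u where "u = (\<lambda>v. R v - b (R v))"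
  define u' where "u' = (\<lambda>v. R' v + b (R' v))"
  have "(\<lambda>v. b (R v)) \<in> M" 
    using vn_comp[OF M b(1) \<open>R \<in> M\<close>] by (simp add: o_def)
  then have "u \<in> M"
    unfolding u_def by (intro vn_diff[OF M] \<open>R \<in> M\<close>)
  have "u' \<in> bounded_ops"
    unfolding u'_def using bounded_ops_closed_comp[OF b' R'(1)]
    by (intro bounded_ops_closed_add R') (simp add: o_def)
  have "adj u = u'"
  proof (rule adj_unique[OF \<open>u' \<in> bounded_ops\<close>])
    fix x y
    \<comment> \<open>In these coordinates \<open>u y = q - b q\<close> and
      \<open>u' x = p + b p\<close>, and skewness of \<open>b\<close> cancels the mixed
      terms.\<close>
    define p q where "p = R' x" and "q = R y"
    have "x = p - b p" "y = q + b q"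
      by (simp_all add: p_def q_def R R')
    moreover have "cinner (p + b p) (q + b q) = cinner (p - b p) (q - b q)"
      by (simp add: cinner_simps b(2))
    ultimately show "cinner (u' x) y = cinner x (u y)"
      by (simp add: u_def u'_def R R')
  qed
  have "unitary u"
    unfolding unitary_def \<open>adj u = u'\<close> using vn_bounded_ops[OF M \<open>u \<in> M\<close>]
    by (simp add: fun_eq_iff u_def u'_def R R')
  have yR: "y (R v) = R (y v)" for v
  proof -
    have u2: "u v = R v - (v - R v)" for v
      using R(2)[of v] by (simp add: u_def algebra_simps)
    have "y (R v - (v - R v)) = R (y v) - (y v - R (y v))"
      using y(2)[OF \<open>u \<in> M\<close> \<open>unitary u\<close>, of v] by (simp add: u2)
    then have "2 *\<^sub>R y (R v) = 2 *\<^sub>R R (y v)"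
      by (simp add: bounded_opsD[OF y(1)] scaleR_2 algebra_simps)
    then show ?thesis by simp
  qed
  have "y v = R (y v + y (b v))"
    using yR[of "v + b v"] by (simp add: R(3) bounded_ops_add[OF y(1)])
  then have "y v + b (y v) = y v + y (b v)"
    by (metis R(2))
  then show ?thesis by simp
qed

text \<open>Every \<open>x\<close> is a combination of the skew elements \<open>x - adj x\<close>
  and \<open>\<i> (x + adj x)\<close>, and a skew element becomes small enough for the Cayley
  transform after rescaling.\<close>

lemma commutant_if_commutes_unitaries:
  fixes M :: "('h::chilbert_space \<Rightarrow> 'h) set"
  assumes M: "von_neumann_algebra M"
    and y: "y \<in> bounded_ops" "\<And>u v. u \<in> M \<Longrightarrow> unitary u \<Longrightarrow> y (u v) = u (y v)"
  shows "y \<in> commutant M"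
proof (rule commutantI[OF y(1)])
  have skew: "y (b v) = b (y v)" if b: "b \<in> M" "\<And>p q. cinner (b p) q = - cinner p (b q)" for b v
  proof -
    obtain K where K: "K \<ge> 0" "\<And>v. norm (b v) \<le> K * norm v"
      using bounded_ops_bound[OF vn_bounded_ops[OF M b(1)]] by blast
    \<comment> \<open>Real, so that skewness survives; the denominator uses \<open>K + 1\<close>
      because \<open>K\<close> may be 0.\<close>
    define e where "e = complex_of_real (1 / (2 * (K + 1)))"
    have "e \<noteq> 0" unfolding e_def of_real_eq_0_iff using K(1) by simp
    have "y (e *\<^sub>C b v) = e *\<^sub>C b (y v)"
    proof (rule commutes_skew_if_commutes_unitaries[OF M y, of "\<lambda>v. e *\<^sub>C b v"])
      show "(\<lambda>v. e *\<^sub>C b v) \<in> M"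
        by (rule vn_cscale[OF M b(1)])
      show "cinner (e *\<^sub>C b p) q = - cinner p (e *\<^sub>C b q)" for p q
        by (simp add: cinner_simps b(2)) (simp add: e_def)
      show "norm (e *\<^sub>C b v) \<le> 1/2 * norm v" for v
      proof -
        have "norm (b v) \<le> (K + 1) * norm v"
          by (rule order_trans[OF K(2)]) (simp add: mult_right_mono)
        then show ?thesis
          unfolding norm_cscale e_def norm_of_real using K(1) by (simp add: field_simps)
      qed
    qed
    then have "e *\<^sub>C y (b v) = e *\<^sub>C b (y v)"
      by (simp add: bounded_ops_cscale[OF y(1)])
    then have "(1 / e) *\<^sub>C e *\<^sub>C y (b v) = (1 / e) *\<^sub>C e *\<^sub>C b (y v)"
      by simp
    then show ?thesis
      using \<open>e \<noteq> 0\<close> by (simp add: cscale_cscale)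
  qed
  fix x v assume x: "x \<in> M"
  note x' = vn_bounded_ops[OF M x] and ax = vn_adj[OF M x]
  have 1: "y (x v - adj x v) = x (y v) - adj x (y v)"
    by (rule skew[of "\<lambda>v. x v - adj x v"])
       (use vn_diff[OF M x ax] in \<open>simp_all add: cinner_simps cinner_adj_left[OF x'] cinner_adj_right[OF x']\<close>)
  have 2: "y (\<i> *\<^sub>C (x v + adj x v)) = \<i> *\<^sub>C (x (y v) + adj x (y v))"
    by (rule skew[of "\<lambda>v. \<i> *\<^sub>C (x v + adj x v)"])
       (use vn_cscale[OF M vn_add[OF M x ax]] in \<open>simp_all add: cinner_simps cinner_adj_left[OF x'] cinner_adj_right[OF x'] algebra_simps\<close>)
  have "(- \<i>) *\<^sub>C y (\<i> *\<^sub>C (x v + adj x v)) = (- \<i>) *\<^sub>C \<i> *\<^sub>C (x (y v) + adj x (y v))"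
    by (simp only: 2)
  then have "y (x v + adj x v) = x (y v) + adj x (y v)"
    by (simp add: bounded_ops_cscale[OF y(1)] cscale_cscale)
  from arg_cong2[OF 1 this, of "(+)"] have "2 *\<^sub>R y (x v) = 2 *\<^sub>R x (y v)"
    by (simp add: bounded_opsD[OF y(1)] scaleR_2)
  then show "y (x v) = x (y v)" by simp
qed

subsection \<open>Normal functionals\<close>

context
  fixes M :: "('h::chilbert_space \<Rightarrow> 'h) set" and \<rho> :: "('h \<Rightarrow> 'h) \<Rightarrow> complex"
  assumes M: "von_neumann_algebra M" and \<rho>: "in_predual M \<rho>"
begin

text \<open>The square sums dominate the series uniformly over all operators with a given bound,
  which serves both summability and dominated convergence.\<close>

lemma in_predualE:
  obtains \<xi> \<eta> where "\<And>x. x \<in> M \<Longrightarrow> \<rho> x = (\<Sum>n. cinner (\<xi> n) (x (\<eta> n)))"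
    "summable (\<lambda>n. (norm (\<xi> n))\<^sup>2 + (norm (\<eta> n))\<^sup>2)"
    "\<And>n x K. \<forall>v. norm (x v) \<le> K * norm v \<Longrightarrow> K \<ge> 0 \<Longrightarrow>
       cmod (cinner (\<xi> n) (x (\<eta> n))) \<le> K * ((norm (\<xi> n))\<^sup>2 + (norm (\<eta> n))\<^sup>2)"
    "\<And>x. x \<in> M \<Longrightarrow> summable (\<lambda>n. cinner (\<xi> n) (x (\<eta> n)))"
proof -
  obtain \<xi> \<eta> :: "nat \<Rightarrow> 'h" where *: "summable (\<lambda>n. (norm (\<xi> n))\<^sup>2)" "summable (\<lambda>n. (norm (\<eta> n))\<^sup>2)"
    "\<And>x. x \<in> M \<Longrightarrow> \<rho> x = (\<Sum>n. cinner (\<xi> n) (x (\<eta> n)))"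
    using \<rho> by (auto simp: in_predual_def)
  have sq: "summable (\<lambda>n. (norm (\<xi> n))\<^sup>2 + (norm (\<eta> n))\<^sup>2)"
    by (intro summable_add *)
  have bound: "cmod (cinner (\<xi> n) (x (\<eta> n))) \<le> K * ((norm (\<xi> n))\<^sup>2 + (norm (\<eta> n))\<^sup>2)"
    if "\<forall>v. norm (x v) \<le> K * norm v" "K \<ge> 0" for n x K
  proof -
    have "cmod (cinner (\<xi> n) (x (\<eta> n))) \<le> norm (\<xi> n) * (K * norm (\<eta> n))"
      by (rule order_trans[OF cmod_cinner_le]) (intro mult_left_mono that(1)[rule_format] norm_ge_zero)
    also have "\<dots> = K * (norm (\<xi> n) * norm (\<eta> n))"
      by simp
    also have "\<dots> \<le> K * ((norm (\<xi> n))\<^sup>2 + (norm (\<eta> n))\<^sup>2)"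
      using sum_squares_bound[of "norm (\<xi> n)" "norm (\<eta> n)"] \<open>K \<ge> 0\<close>
        mult_nonneg_nonneg[OF norm_ge_zero[of "\<xi> n"] norm_ge_zero[of "\<eta> n"]]
      by (intro mult_left_mono) linarith+
    finally show ?thesis .
  qed
  have "summable (\<lambda>n. cinner (\<xi> n) (x (\<eta> n)))" if "x \<in> M" for x
  proof -
    obtain K where "K \<ge> 0" "\<And>v. norm (x v) \<le> K * norm v"
      using bounded_ops_bound[OF vn_bounded_ops[OF M \<open>x \<in> M\<close>]] by blast
    then show ?thesis
      by (intro summable_comparison_test'[OF summable_mult[OF sq, of K]] bound allI)
  qed
  then show thesis
    using that[of \<xi> \<eta>] *(3) sq bound by blast
qed

lemma in_predual_add:
  assumes "x \<in> M" "y \<in> M"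
  shows "\<rho> (\<lambda>v. x v + y v) = \<rho> x + \<rho> y"
  by (rule in_predualE) (simp add: assms vn_add[OF M] cinner_simps suminf_add)

lemma in_predual_cscale:
  assumes "x \<in> M"
  shows "\<rho> (\<lambda>v. c *\<^sub>C x v) = c * \<rho> x"
  by (rule in_predualE) (simp add: assms vn_cscale[OF M] cinner_simps suminf_mult)

text \<open>Dominated convergence for series: a common operator bound upgrades strong convergence to
  convergence under every normal functional.\<close>

lemma in_predual_tendsto:
  assumes "\<And>n. Y n \<in> M" "y \<in> M" "K \<ge> 0" "\<And>n v. norm (Y n v) \<le> K * norm v"
    and "\<And>v. (\<lambda>n. Y n v) \<longlonglongrightarrow> y v"
  shows "(\<lambda>n. \<rho> (Y n)) \<longlonglongrightarrow> \<rho> y"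
proof -
  obtain \<xi> \<eta> where \<rho>_eq: "\<And>x. x \<in> M \<Longrightarrow> \<rho> x = (\<Sum>n. cinner (\<xi> n) (x (\<eta> n)))"
    and sq: "summable (\<lambda>n. (norm (\<xi> n))\<^sup>2 + (norm (\<eta> n))\<^sup>2)"
    and bound: "\<And>n x K. \<forall>v. norm (x v) \<le> K * norm v \<Longrightarrow> K \<ge> 0 \<Longrightarrow>
       cmod (cinner (\<xi> n) (x (\<eta> n))) \<le> K * ((norm (\<xi> n))\<^sup>2 + (norm (\<eta> n))\<^sup>2)"
    and "\<And>x. x \<in> M \<Longrightarrow> summable (\<lambda>n. cinner (\<xi> n) (x (\<eta> n)))"
    by (rule in_predualE) blast
  have "(\<lambda>n. \<Sum>k. cinner (\<xi> k) (Y n (\<eta> k))) \<longlonglongrightarrow> (\<Sum>k. cinner (\<xi> k) (y (\<eta> k)))"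
  proof (rule tannerys_theorem[THEN conjunct2, THEN conjunct2])
    show "(\<lambda>n. cinner (\<xi> k) (Y n (\<eta> k))) \<longlonglongrightarrow> cinner (\<xi> k) (y (\<eta> k))" for k
      by (intro tendsto_intros assms)
    show "\<forall>\<^sub>F (k, n) in sequentially \<times>\<^sub>F sequentially.
        cmod (cinner (\<xi> k) (Y n (\<eta> k))) \<le> K * ((norm (\<xi> k))\<^sup>2 + (norm (\<eta> k))\<^sup>2)"
      by (intro always_eventually) (auto intro: bound assms)
  qed (auto intro: summable_mult sq)
  then show ?thesis
    by (simp add: \<rho>_eq assms)
qed

end

lemma in_predual_cinner: "in_predual M (\<lambda>x. cinner \<xi> (x \<eta>))"
proof -
  have "cinner \<xi> (x \<eta>) = (\<Sum>n. cinner (if n = 0 then \<xi> else 0) (x (if n = 0 then \<eta> else 0)))"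
    if "x \<in> M" for x
    by (subst suminf_finite[of "{0}"]) auto
  moreover have "summable (\<lambda>n. (norm (if n = 0 then \<zeta> else 0))\<^sup>2)" for \<zeta> :: 'a
    by (rule summable_finite[of "{0::nat}"]) auto
  ultimately show ?thesis
    unfolding in_predual_def
    by (intro exI[of _ "\<lambda>n. if n = 0 then \<xi> else 0"] exI[of _ "\<lambda>n. if n = 0 then \<eta> else 0"]) blast
qed

lemma bounded_ops_Cauchy_dense:
  fixes Y :: "nat \<Rightarrow> 'h::chilbert_space \<Rightarrow> 'h"
  assumes "closure D = UNIV" "K \<ge> 0"
    and Y: "\<And>n. Y n \<in> bounded_ops" "\<And>n v. norm (Y n v) \<le> K * norm v"
    and D: "\<And>v. v \<in> D \<Longrightarrow> Cauchy (\<lambda>n. Y n v)"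
  shows "Cauchy (\<lambda>n. Y n v)"
proof (rule metric_CauchyI)
  fix e :: real assume "e > 0"
  define d where "d = e / (3 * (K + 1))"
  have "d > 0"
    using \<open>e > 0\<close> \<open>K \<ge> 0\<close> by (simp add: d_def)
  then obtain w where w: "w \<in> D" "dist w v < d"
    using assms(1) closure_approachable[of v D] by auto
  obtain N where N: "\<And>m n. m \<ge> N \<Longrightarrow> n \<ge> N \<Longrightarrow> dist (Y m w) (Y n w) < e / 3"
    using metric_CauchyD[OF D[OF w(1)], of "e / 3"] \<open>e > 0\<close> by auto
  have near: "dist (Y n v) (Y n w) \<le> e / 3" for n
  proof -
    have "dist (Y n v) (Y n w) = norm (Y n (v - w))"
      by (simp add: dist_norm bounded_ops_diff[OF Y(1)])
    also have "\<dots> \<le> K * d"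
      using w(2) by (intro order_trans[OF Y(2)] mult_left_mono \<open>K \<ge> 0\<close>)
        (simp add: dist_norm norm_minus_commute)
    also have "\<dots> \<le> e / 3"
      using \<open>e > 0\<close> \<open>K \<ge> 0\<close> by (simp add: d_def field_simps)
    finally show ?thesis .
  qed
  have "dist (Y m v) (Y n v) < e" if "m \<ge> N" "n \<ge> N" for m n
  proof -
    have "dist (Y m v) (Y n v) \<le> dist (Y m v) (Y m w) + dist (Y m w) (Y n w) + dist (Y n v) (Y n w)"
      by (metis add_right_mono dist_commute dist_triangle dist_triangle_le)
    then show ?thesis
      using near[of m] near[of n] N[OF that] by linarith
  qed
  then show "\<exists>N. \<forall>m\<ge>N. \<forall>n\<ge>N. dist (Y m v) (Y n v) < e"
    by blast
qed

subsection \<open>Uniqueness of the trace\<close>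

locale tracial_factor =
  fixes M :: "('h::chilbert_space \<Rightarrow> 'h) set" and \<Omega> :: 'h
  assumes factor: "factor M" and standard: "acts_standardly M \<Omega>"
begin

lemma vn: "von_neumann_algebra M"
  using factor by (simp add: factor_def)

lemmas M_ops = vn_bounded_ops[OF vn]
  and M_id = vn_id[OF vn]
  and M_add = vn_add[OF vn]
  and M_diff = vn_diff[OF vn]
  and M_cscale = vn_cscale[OF vn]
  and M_comp = vn_comp[OF vn]
  and M_adj = vn_adj[OF vn]

lemma norm_\<Omega>: "norm \<Omega> = 1"
  using standard by (simp add: acts_standardly_def)

lemma cinner_\<Omega>: "cinner \<Omega> \<Omega> = 1"
  by (simp add: cinner_self norm_\<Omega>)

lemma trace: "x \<in> M \<Longrightarrow> y \<in> M \<Longrightarrow> tau \<Omega> (x \<circ> y) = tau \<Omega> (y \<circ> x)"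
  using standard by (simp add: acts_standardly_def)

lemma dense: "closure ((\<lambda>x. x \<Omega>) ` M) = UNIV"
  using standard by (simp add: acts_standardly_def)

lemma dense_induct:
  assumes "closed {v. P v}" "\<And>x. x \<in> M \<Longrightarrow> P (x \<Omega>)"
  shows "P v"
  using closure_UNIV_induct[OF dense] assms by blast

lemma separating:
  assumes "x \<in> M" "y \<in> M" "x \<Omega> = y \<Omega>"
  shows "x = y"
proof -
  have "(\<lambda>v. x v - y v) = (\<lambda>_. 0)"
    using standard M_diff[OF assms(1,2)] assms(3) by (auto simp: acts_standardly_def)
  then show ?thesis
    by (simp add: fun_eq_iff)
qed

text \<open>The trace property in vector form: sending \<open>x \<Omega>\<close> to
  \<open>adj x \<Omega>\<close> is antiunitary, the modular conjugation of the tracial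
  vector.\<close>

lemma cinner_flip:
  assumes "x \<in> M" "y \<in> M"
  shows "cinner (x \<Omega>) (y \<Omega>) = cinner (adj y \<Omega>) (adj x \<Omega>)"
  using trace[OF M_adj[OF assms(1)] assms(2)]
    cinner_adj_right[OF M_ops[OF assms(1)], of \<Omega> "y \<Omega>"]
    cinner_adj_left[OF M_ops[OF assms(2)], of \<Omega> "adj x \<Omega>"]
  by (simp add: tau_def)

lemma norm_adj_\<Omega>:
  assumes "x \<in> M"
  shows "norm (adj x \<Omega>) = norm (x \<Omega>)"
  using cinner_flip[OF assms assms] unfolding cinner_self of_real_eq_iff by simp

text \<open>Taking adjoints turns right multiplication by \<open>x\<close> into left multiplication
  by \<open>adj x\<close>. This is how convergence at \<Omega> spreads to the dense set of vectors
  \<open>x \<Omega>\<close>.\<close>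

lemma norm_right_mult_le:
  assumes "x \<in> M" "y \<in> M" "\<And>v. norm (adj x v) \<le> K * norm v"
  shows "norm (y (x \<Omega>)) \<le> K * norm (y \<Omega>)"
proof -
  have "norm (y (x \<Omega>)) = norm (adj x (adj y \<Omega>))"
    using norm_adj_\<Omega>[OF M_comp[OF assms(2,1)]] assms by (simp add: adj_comp M_ops)
  also have "\<dots> \<le> K * norm (adj y \<Omega>)"
    by (rule assms(3))
  finally show ?thesis
    using assms by (simp add: norm_adj_\<Omega>)
qed

text \<open>Operator-norm balls of M are complete for the 2-norm: convergence at \<Omega> forces
  strong convergence, and the limit lies in the double commutant.\<close>

lemma bounded_limit:
  assumes Y: "\<And>n. Y n \<in> M" "K \<ge> 0" "\<And>n v. norm (Y n v) \<le> K * norm v"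
    and lim: "(\<lambda>n. Y n \<Omega>) \<longlonglongrightarrow> \<xi>"
  obtains y where "y \<in> M" "\<And>v. norm (y v) \<le> K * norm v" "\<And>v. (\<lambda>n. Y n v) \<longlonglongrightarrow> y v" "y \<Omega> = \<xi>"
proof -
  have "Cauchy (\<lambda>n. Y n v)" for v
  proof (rule bounded_ops_Cauchy_dense[OF dense Y(2) M_ops[OF Y(1)] Y(3)])
    fix v assume "v \<in> (\<lambda>x. x \<Omega>) ` M"
    then obtain x where x: "x \<in> M" "v = x \<Omega>" by blast
    obtain L where L: "L \<ge> 0" "\<And>v. norm (adj x v) \<le> L * norm v"
      using bounded_ops_bound[OF M_ops[OF M_adj[OF x(1)]]] by blast
    show "Cauchy (\<lambda>n. Y n v)"
    proof (rule metric_CauchyI)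
      fix e :: real assume "e > 0"
      then obtain N where N: "\<And>m n. m \<ge> N \<Longrightarrow> n \<ge> N \<Longrightarrow> dist (Y m \<Omega>) (Y n \<Omega>) < e / (L + 1)"
        using metric_CauchyD[OF LIMSEQ_imp_Cauchy[OF lim], of "e / (L + 1)"] L(1) by auto
      have "dist (Y m v) (Y n v) < e" if "m \<ge> N" "n \<ge> N" for m n
      proof -
        have "dist (Y m v) (Y n v) \<le> L * dist (Y m \<Omega>) (Y n \<Omega>)"
          using norm_right_mult_le[OF x(1) M_diff[OF Y(1)[of m] Y(1)[of n]] L(2)]
          by (simp add: dist_norm x(2))
        also have "\<dots> \<le> (L + 1) * dist (Y m \<Omega>) (Y n \<Omega>)"
          by (simp add: mult_right_mono)
        also have "\<dots> < e"
          using N[OF that] L(1) by (simp add: field_simps)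
        finally show ?thesis .
      qed
      then show "\<exists>N. \<forall>m\<ge>N. \<forall>n\<ge>N. dist (Y m v) (Y n v) < e"
        by blast
    qed
  qed
  then have "\<exists>w. (\<lambda>n. Y n v) \<longlonglongrightarrow> w" for v
    using Cauchy_convergent convergent_def by blast
  then obtain y where y: "\<And>v. (\<lambda>n. Y n v) \<longlonglongrightarrow> y v"
    by metis
  have bound: "norm (y v) \<le> K * norm v" for v
    by (rule LIMSEQ_le_const2[OF tendsto_norm[OF y]]) (use Y(3) in blast)
  have "y \<in> bounded_ops"
  proof (rule bounded_opsI[OF _ _ bound])
    show "y (v + w) = y v + y w" for v w
      using LIMSEQ_unique[OF y[of "v + w"]] tendsto_add[OF y[of v] y[of w]]
      by (simp add: bounded_ops_add[OF M_ops[OF Y(1)]])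
    show "y (c *\<^sub>C v) = c *\<^sub>C y v" for c v
      using LIMSEQ_unique[OF y[of "c *\<^sub>C v"]] tendsto_cscale[OF y[of v], of c]
      by (simp add: bounded_ops_cscale[OF M_ops[OF Y(1)]])
  qed
  then have "y \<in> M"
  proof (rule vnI[OF vn])
    fix S v assume S: "S \<in> commutant M"
    have "(\<lambda>n. Y n (S v)) \<longlonglongrightarrow> S (y v)"
      using bounded_ops_tendsto[OF commutant_bounded_ops[OF S] y[of v]]
      by (simp add: commutantD[OF S Y(1)])
    then show "y (S v) = S (y v)"
      using LIMSEQ_unique[OF y[of "S v"]] by simp
  qed
  then show thesis
    using that bound y LIMSEQ_unique[OF y[of \<Omega>] lim] by blast
qed

lemma unitary_norm:
  assumes "unitary u"
  shows "norm (u v) = norm v" "norm (adj u v) = norm v"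
proof -
  have u: "u \<in> bounded_ops" "adj u (u v) = v" "u (adj u v) = v"
    using assms by (simp_all add: unitary_def fun_eq_iff)
  have "cinner (u v) (u v) = cinner v v" "cinner (adj u v) (adj u v) = cinner v v"
    using cinner_adj_left[OF u(1), of "u v" v] cinner_adj_right[OF u(1), of "adj u v" v] u by simp_all
  then show "norm (u v) = norm v" "norm (adj u v) = norm v"
    unfolding cinner_self of_real_eq_iff by simp_all
qed

text \<open>The constraint set replaces the convex hull of the unitary conjugates in Dixmier's averaging
  argument: it is convex, invariant under unitary conjugation and complete for the 2-norm, so its
  element of minimal 2-norm commutes with all unitaries and is a scalar.\<close>

lemma normal_trace_unique:
  assumes \<phi>: "in_predual M \<phi>" "\<And>x y. x \<in> M \<Longrightarrow> y \<in> M \<Longrightarrow> \<phi> (x \<circ> y) = \<phi> (y \<circ> x)" and x: "x \<in> M"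
  shows "\<phi> x = tau \<Omega> x * \<phi> id"
proof -
  have \<tau>: "in_predual M (tau \<Omega>)"
    unfolding tau_def by (rule in_predual_cinner)
  note \<phi>_add = in_predual_add[OF vn \<phi>(1)] and \<phi>_cscale = in_predual_cscale[OF vn \<phi>(1)]
    and \<tau>_add = in_predual_add[OF vn \<tau>] and \<tau>_cscale = in_predual_cscale[OF vn \<tau>]
  obtain K where K: "K \<ge> 0" "\<And>v. norm (x v) \<le> K * norm v"
    using bounded_ops_bound[OF M_ops[OF x]] by blast
  define W where "W = {y \<in> M. (\<forall>v. norm (y v) \<le> K * norm v) \<and> \<phi> y = \<phi> x \<and> tau \<Omega> y = tau \<Omega> x}"
  have "closed ((\<lambda>y. y \<Omega>) ` W)"
  proof (unfold closed_sequential_limits, intro allI impI, elim conjE)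
    fix z \<xi> assume "\<forall>n. z n \<in> (\<lambda>y. y \<Omega>) ` W" and lim: "z \<longlonglongrightarrow> \<xi>"
    then obtain Y where Y: "\<And>n. Y n \<in> W" "\<And>n. z n = Y n \<Omega>"
      unfolding image_iff by metis
    then have Y': "\<And>n. Y n \<in> M" "\<And>n v. norm (Y n v) \<le> K * norm v"
      by (auto simp: W_def)
    have "(\<lambda>n. Y n \<Omega>) \<longlonglongrightarrow> \<xi>"
      using lim by (simp add: Y(2)[symmetric])
    then obtain y where y: "y \<in> M" "\<And>v. norm (y v) \<le> K * norm v" "\<And>v. (\<lambda>n. Y n v) \<longlonglongrightarrow> y v" "y \<Omega> = \<xi>"
      by (rule bounded_limit[of Y K \<xi>, OF Y'(1) K(1) Y'(2)]) blast
    have "(\<lambda>n. \<phi> (Y n)) \<longlonglongrightarrow> \<phi> y" "(\<lambda>n. tau \<Omega> (Y n)) \<longlonglongrightarrow> tau \<Omega> y"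
      using in_predual_tendsto[OF vn \<phi>(1), of Y y K] in_predual_tendsto[OF vn \<tau>, of Y y K]
        Y' y K(1) by auto
    then have "y \<in> W"
      using Y(1) y(1,2) by (simp add: W_def LIMSEQ_const_iff)
    then show "\<xi> \<in> (\<lambda>y. y \<Omega>) ` W"
      using y(4) by blast
  qed
  moreover have "convex ((\<lambda>y. y \<Omega>) ` W)"
  proof (rule convexI)
    fix v w and s t :: real
    assume "v \<in> (\<lambda>y. y \<Omega>) ` W" "w \<in> (\<lambda>y. y \<Omega>) ` W" and st: "0 \<le> s" "0 \<le> t" "s + t = 1"
    then obtain y z where yz: "y \<in> W" "z \<in> W" "v = y \<Omega>" "w = z \<Omega>"
      by blast
    define q where "q = (\<lambda>v. complex_of_real s *\<^sub>C y v + complex_of_real t *\<^sub>C z v)"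
    have yzM: "y \<in> M" "z \<in> M"
      using yz by (auto simp: W_def)
    have "norm (q v) \<le> K * norm v" for v
    proof -
      have "norm (q v) \<le> s * norm (y v) + t * norm (z v)"
        unfolding q_def using st by (intro norm_triangle_le) (simp add: norm_cscale)
      also have "\<dots> \<le> s * (K * norm v) + t * (K * norm v)"
        using yz st by (intro add_mono mult_left_mono) (auto simp: W_def)
      also have "\<dots> = K * norm v"
        using st by (simp flip: distrib_right)
      finally show ?thesis .
    qed
    moreover have "complex_of_real s * c + complex_of_real t * c = c" for c
      using st by (simp flip: distrib_right of_real_add)
    ultimately have "q \<in> W"
      using yz yzM by (simp add: W_def q_def M_add M_cscale \<phi>_add \<phi>_cscale \<tau>_add \<tau>_cscale)
    moreover have "s *\<^sub>R v + t *\<^sub>R w = q \<Omega>"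
      by (simp add: q_def yz cscale_of_real)
    ultimately show "s *\<^sub>R v + t *\<^sub>R w \<in> (\<lambda>y. y \<Omega>) ` W"
      by blast
  qed
  moreover have "(\<lambda>y. y \<Omega>) ` W \<noteq> {}"
    using x K by (auto simp: W_def)
  ultimately obtain \<xi> where \<xi>: "\<xi> \<in> (\<lambda>y. y \<Omega>) ` W"
    "\<And>v. v \<in> (\<lambda>y. y \<Omega>) ` W \<Longrightarrow> norm v = norm \<xi> \<Longrightarrow> v = \<xi>"
    by (rule convex_min_norm) blast
  then obtain y where y: "y \<in> W" "\<xi> = y \<Omega>"
    by blast
  have min: "z \<Omega> = y \<Omega>" if "z \<in> W" "norm (z \<Omega>) = norm (y \<Omega>)" for z
    using \<xi>(2) that y(2) by blast
  have yM: "y \<in> M"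
    using y by (simp add: W_def)
  have "y \<in> commutant M"
  proof (rule commutant_if_commutes_unitaries[OF vn M_ops[OF yM]])
    fix u v assume u: "u \<in> M" "unitary u"
    have uu: "u \<circ> adj u = id" "adj u \<circ> u = id"
      using u(2) by (simp_all add: unitary_def)
    note au = M_adj[OF u(1)]
    \<comment> \<open>Bracketed so that the trace property of \<open>\<phi>\<close> and of
      \<open>tau\<close> moves the outer \<open>u\<close> to the right, where it cancels.\<close>
    define z where "z = u \<circ> (y \<circ> adj u)"
    have yau: "y \<circ> adj u \<in> M"
      by (intro M_comp yM au)
    have zu: "(y \<circ> adj u) \<circ> u = y"
      by (simp add: o_assoc[symmetric] uu)
    have "\<phi> z = \<phi> y" "tau \<Omega> z = tau \<Omega> y"
      unfolding z_def using \<phi>(2)[OF u(1) yau] trace[OF u(1) yau] zu by simp_all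
    moreover have "z \<in> M"
      unfolding z_def by (intro M_comp yau u)
    moreover have "norm (z v) \<le> K * norm v" for v
    proof -
      have "norm (y (adj u v)) \<le> K * norm (adj u v)"
        using y by (simp add: W_def)
      then show ?thesis
        by (simp add: z_def unitary_norm[OF u(2)])
    qed
    ultimately have "z \<in> W"
      using y by (simp add: W_def)
    \<comment> \<open>Conjugation preserves the 2-norm: \<open>u\<close> acts isometrically on the
      left and, after an adjoint, on the right. Uniqueness of the minimizer then gives
      \<open>z = y\<close>.\<close>
    have "norm (z \<Omega>) = norm (adj u (adj y \<Omega>))"
      using norm_adj_\<Omega>[OF yau] yM u(1) au
      by (simp add: z_def unitary_norm[OF u(2)] adj_comp adj_adj M_ops) 
    also have "\<dots> = norm (y \<Omega>)"
      by (simp add: unitary_norm[OF u(2)] norm_adj_\<Omega> yM)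
    finally have "z = y"
      using min[OF \<open>z \<in> W\<close>] by (intro separating \<open>z \<in> M\<close> yM)
    then have "u (y (adj u (u v))) = y (u v)"
      by (auto simp: z_def fun_eq_iff)
    then show "y (u v) = u (y v)"
      using uu(2) by (simp add: fun_eq_iff)
  qed
  \<comment> \<open>The centre of a factor consists of scalars, so \<open>\<phi>\<close> and
    \<open>tau\<close> are compared on a multiple of the identity.\<close>
  then have "y \<in> range cscale"
    using yM factor by (auto simp: factor_def)
  then obtain c where c: "y = (\<lambda>v. c *\<^sub>C id v)"
    by auto
  have "\<phi> y = c * \<phi> id" "tau \<Omega> y = c"
    using \<phi>_cscale[OF M_id, of c] \<tau>_cscale[OF M_id, of c] c cinner_\<Omega> by (simp_all add: tau_def)
  moreover have "\<phi> y = \<phi> x" "tau \<Omega> y = tau \<Omega> x"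
    using y(1) by (simp_all add: W_def)
  ultimately show ?thesis
    by simp
qed

end

subsection \<open>Extension of isometries\<close>

lemma isometry_extension:
  fixes f :: "'h::chilbert_space \<Rightarrow> 'h"
  assumes dense: "closure D = UNIV"
    and D: "\<And>v w. v \<in> D \<Longrightarrow> w \<in> D \<Longrightarrow> v + w \<in> D" "\<And>c v. v \<in> D \<Longrightarrow> c *\<^sub>C v \<in> D"
    and f: "\<And>v w. v \<in> D \<Longrightarrow> w \<in> D \<Longrightarrow> f (v + w) = f v + f w"
      "\<And>c v. v \<in> D \<Longrightarrow> f (c *\<^sub>C v) = c *\<^sub>C f v"
      "\<And>v. v \<in> D \<Longrightarrow> norm (f v) = norm v"
  obtains g where "g \<in> bounded_ops" "\<And>v. norm (g v) = norm v" "\<And>v. v \<in> D \<Longrightarrow> g v = f v"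
proof -
  have dist: "dist (f v) (f w) = dist v w" if "v \<in> D" "w \<in> D" for v w
  proof -
    have "f (v + (-1) *\<^sub>C w) = f v + (-1) *\<^sub>C f w"
      using f(1)[OF that(1) D(2)[OF that(2)]] f(2)[OF that(2)] by simp
    then have "f v - f w = f (v + (-1) *\<^sub>C w)"
      by (simp add: cscale_minus_left)
    then have "norm (f v - f w) = norm (v + (-1) *\<^sub>C w)"
      using f(3)[OF D(1)[OF that(1) D(2)[OF that(2)]]] by simp
    then show ?thesis
      by (simp add: dist_norm cscale_minus_left)
  qed
  have "uniformly_continuous_on D f"
    unfolding uniformly_continuous_on_def using dist by metis
  then obtain g where g: "uniformly_continuous_on (closure D) g" "\<And>v. v \<in> D \<Longrightarrow> f v = g v"
    by (rule uniformly_continuous_on_extension_on_closure) blast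
  then have cont: "continuous_on UNIV g"
    by (simp add: dense uniformly_continuous_imp_continuous)
  note c = continuous_on_compose2[OF cont _ subset_UNIV]
  have norm1: "norm (g v) = norm v" if "v \<in> D" for v
    using f(3)[OF that] g(2)[OF that] by simp
  have norm: "norm (g v) = norm v" for v
    by (rule closure_UNIV_induct[OF dense])
       (auto intro!: closed_Collect_eq continuous_intros cont norm1)
  \<comment> \<open>Additivity is extended by continuity in one variable at a time; here
    \<open>w\<close> is still in \<open>D\<close>.\<close>
  have add1: "g (v + w) = g v + g w" if "w \<in> D" for v w
    by (rule closure_UNIV_induct[OF dense, of "\<lambda>v. g (v + w) = g v + g w"])
       (use that in \<open>auto intro!: closed_Collect_eq continuous_intros cont c simp: f D simp flip: g(2)\<close>)
  have add: "g (v + w) = g v + g w" for v w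
    by (rule closure_UNIV_induct[OF dense, of "\<lambda>w. g (v + w) = g v + g w"])
       (auto intro!: closed_Collect_eq continuous_intros cont c add1)
  have scale: "g (c *\<^sub>C v) = c *\<^sub>C g v" for c v
    by (rule closure_UNIV_induct[OF dense, of "\<lambda>v. g (c *\<^sub>C v) = c *\<^sub>C g v"])
       (auto intro!: closed_Collect_eq continuous_intros cont c simp: f D simp flip: g(2))
  have "g \<in> bounded_ops"
    by (rule bounded_opsI[where K = 1]) (simp_all add: add scale norm)
  with norm g(2) that show thesis
    by metis
qed

lemma isometry_cinner:
  assumes "T \<in> bounded_ops" "\<And>v. norm (T v) = norm v"
  shows "cinner (T v) (T w) = cinner v w"
proof -
  have "inner (T v) (T w) = inner v w" for v w
  proof -
    have "(norm (T (v + w)))\<^sup>2 = (norm (v + w))\<^sup>2" "(norm (T v))\<^sup>2 = (norm v)\<^sup>2" "(norm (T w))\<^sup>2 = (norm w)\<^sup>2"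
      by (simp_all only: assms(2))
    then show ?thesis
      unfolding bounded_ops_add[OF assms(1)] power2_norm_eq_inner
      by (simp add: inner_simps inner_commute)
  qed
  then show ?thesis
    unfolding cinner_eq_Complex by (simp flip: bounded_ops_cscale[OF assms(1)])
qed

section \<open>The canonical unit of an \<open>E\<^sub>0\<close>-semigroup\<close>

locale tracial_E0_semigroup = tracial_factor M \<Omega>
  for M :: "('h::chilbert_space \<Rightarrow> 'h) set" and \<Omega> :: 'h +
  fixes \<alpha> :: "real \<Rightarrow> ('h \<Rightarrow> 'h) \<Rightarrow> ('h \<Rightarrow> 'h)"
  assumes E0: "E0_semigroup M \<alpha>"
begin

lemma endo: "t \<ge> 0 \<Longrightarrow> normal_unital_star_endomorphism M (\<alpha> t)"
  using E0 by (simp add: E0_semigroup_def)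

lemma
  assumes "t \<ge> 0"
  shows \<alpha>_M: "x \<in> M \<Longrightarrow> \<alpha> t x \<in> M"
    and \<alpha>_add: "x \<in> M \<Longrightarrow> y \<in> M \<Longrightarrow> \<alpha> t (\<lambda>v. x v + y v) = (\<lambda>v. \<alpha> t x v + \<alpha> t y v)"
    and \<alpha>_cscale: "x \<in> M \<Longrightarrow> \<alpha> t (\<lambda>v. c *\<^sub>C x v) = (\<lambda>v. c *\<^sub>C \<alpha> t x v)"
    and \<alpha>_comp: "x \<in> M \<Longrightarrow> y \<in> M \<Longrightarrow> \<alpha> t (x \<circ> y) = \<alpha> t x \<circ> \<alpha> t y"
    and \<alpha>_adj: "x \<in> M \<Longrightarrow> \<alpha> t (adj x) = adj (\<alpha> t x)"
    and \<alpha>_id: "\<alpha> t id = id"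
    and \<alpha>_normal: "in_predual M \<rho> \<Longrightarrow> in_predual M (\<lambda>x. \<rho> (\<alpha> t x))"
  using endo[OF assms] unfolding normal_unital_star_endomorphism_def by blast+

lemma \<alpha>_zero: "x \<in> M \<Longrightarrow> \<alpha> 0 x = x"
  using E0 by (simp add: E0_semigroup_def)

lemma \<alpha>_plus: "s \<ge> 0 \<Longrightarrow> t \<ge> 0 \<Longrightarrow> x \<in> M \<Longrightarrow> \<alpha> s (\<alpha> t x) = \<alpha> (s + t) x"
  using E0 by (simp add: E0_semigroup_def)

lemma \<alpha>_continuous: "x \<in> M \<Longrightarrow> in_predual M \<rho> \<Longrightarrow> continuous_on {0..} (\<lambda>t. \<rho> (\<alpha> t x))"
  using E0 by (simp add: E0_semigroup_def)

lemma \<alpha>_image_ops: "t \<ge> 0 \<Longrightarrow> \<alpha> t ` M \<subseteq> bounded_ops"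
  using \<alpha>_M M_ops by blast

section \<open>Relative commutants and the factorization of the trace\<close>

definition rel_commutant :: "real \<Rightarrow> ('h \<Rightarrow> 'h) set" where
  "rel_commutant t = M \<inter> commutant (\<alpha> t ` M)"

lemma rel_commutant_M: "x \<in> rel_commutant t \<Longrightarrow> x \<in> M"
  by (simp add: rel_commutant_def)

lemma rel_commutantD: "x \<in> rel_commutant t \<Longrightarrow> y \<in> M \<Longrightarrow> x (\<alpha> t y v) = \<alpha> t y (x v)"
  by (auto simp: rel_commutant_def commutantD)

lemma
  assumes t: "t \<ge> 0"
  shows rel_commutant_id: "id \<in> rel_commutant t"
    and rel_commutant_add: "x \<in> rel_commutant t \<Longrightarrow> y \<in> rel_commutant t \<Longrightarrow>
      (\<lambda>v. x v + y v) \<in> rel_commutant t"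
    and rel_commutant_cscale: "x \<in> rel_commutant t \<Longrightarrow> (\<lambda>v. c *\<^sub>C x v) \<in> rel_commutant t"
    and rel_commutant_comp: "x \<in> rel_commutant t \<Longrightarrow> y \<in> rel_commutant t \<Longrightarrow>
      x \<circ> y \<in> rel_commutant t"
    and rel_commutant_adj: "x \<in> rel_commutant t \<Longrightarrow> adj x \<in> rel_commutant t"
proof -
  note sub = \<alpha>_image_ops[OF t]
  show "id \<in> rel_commutant t"
    by (simp add: rel_commutant_def commutant_id[OF sub] M_id)
  show "(\<lambda>v. x v + y v) \<in> rel_commutant t" if "x \<in> rel_commutant t" "y \<in> rel_commutant t"
    using that by (simp add: rel_commutant_def commutant_add[OF sub] M_add)
  show "(\<lambda>v. c *\<^sub>C x v) \<in> rel_commutant t" if "x \<in> rel_commutant t"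
    using that by (simp add: rel_commutant_def commutant_cscale[OF sub] M_cscale)
  show "x \<circ> y \<in> rel_commutant t" if "x \<in> rel_commutant t" "y \<in> rel_commutant t"
    using that by (simp add: rel_commutant_def commutant_comp M_comp)
  have "adj z \<in> \<alpha> t ` M" if "z \<in> \<alpha> t ` M" for z
    using that by (auto simp: M_adj simp flip: \<alpha>_adj[OF t])
  then show "adj x \<in> rel_commutant t" if "x \<in> rel_commutant t"
    using that by (simp add: rel_commutant_def commutant_adj[OF sub] M_adj)
qed

text \<open>As a function of \<open>z\<close> the left side is normal, and it is tracial because
  \<open>p\<close> commutes with the range of \<open>\<alpha> t\<close>; uniqueness of the trace
  makes it a multiple of \<open>tau \<Omega>\<close>, with value \<open>tau \<Omega> p\<close> at
  the identity.\<close>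

lemma tau_factorizes:
  assumes t: "t \<ge> 0" and p: "p \<in> rel_commutant t" and z: "z \<in> M"
  shows "tau \<Omega> (p \<circ> \<alpha> t z) = tau \<Omega> p * tau \<Omega> z"
proof -
  note pM = rel_commutant_M[OF p]
  \<comment> \<open>Moving \<open>p\<close> to the left slot exhibits a vector functional composed
    with the normal map \<open>\<alpha> t\<close>.\<close>
  define \<phi> where "\<phi> = (\<lambda>z. cinner (adj p \<Omega>) (\<alpha> t z \<Omega>))"
  have \<phi>_eq: "\<phi> x = tau \<Omega> (p \<circ> \<alpha> t x)" for x
    by (simp add: \<phi>_def tau_def cinner_adj_left M_ops pM)
  have "in_predual M \<phi>"
    unfolding \<phi>_def by (rule \<alpha>_normal[OF t in_predual_cinner])
  moreover have "\<phi> (x \<circ> y) = \<phi> (y \<circ> x)" if "x \<in> M" "y \<in> M" for x y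
  proof -
    note xy = \<alpha>_M[OF t that(1)] \<alpha>_M[OF t that(2)]
    have "\<phi> (x \<circ> y) = tau \<Omega> (\<alpha> t x \<circ> (p \<circ> \<alpha> t y))"
      using that by (simp add: \<phi>_eq tau_def \<alpha>_comp[OF t] rel_commutantD[OF p])
    also have "\<dots> = tau \<Omega> ((p \<circ> \<alpha> t y) \<circ> \<alpha> t x)"
      by (intro trace xy M_comp pM)
    also have "\<dots> = \<phi> (y \<circ> x)"
      using that by (simp add: \<phi>_eq \<alpha>_comp[OF t] o_assoc)
    finally show ?thesis .
  qed
  ultimately have "\<phi> z = tau \<Omega> z * \<phi> id"
    using z by (rule normal_trace_unique)
  then show ?thesis
    by (simp add: \<phi>_eq \<alpha>_id[OF t])
qed

text \<open>The vectors \<open>x (\<alpha> t y \<Omega>)\<close> behave like elementary tensors of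
  \<open>x \<Omega>\<close> and \<open>y \<Omega>\<close>. The orthogonality relations and
  exponential laws below are instances.\<close>

lemma cinner_factorizes:
  assumes t: "t \<ge> 0" and x: "x \<in> rel_commutant t" "x' \<in> rel_commutant t" and y: "y \<in> M" "y' \<in> M"
  shows "cinner (x (\<alpha> t y \<Omega>)) (x' (\<alpha> t y' \<Omega>)) = cinner (x \<Omega>) (x' \<Omega>) * cinner (y \<Omega>) (y' \<Omega>)"
proof -
  note xM = x[THEN rel_commutant_M]
  define p where "p = adj x \<circ> x'"
  have p: "p \<in> rel_commutant t"
    unfolding p_def by (intro rel_commutant_comp rel_commutant_adj t x)
  note pM = rel_commutant_M[OF p]
  have "cinner (x (\<alpha> t y \<Omega>)) (x' (\<alpha> t y' \<Omega>)) = tau \<Omega> (\<alpha> t (adj y) \<circ> (p \<circ> \<alpha> t y'))"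
    using y xM by (simp add: p_def tau_def \<alpha>_adj[OF t] cinner_adj_right M_ops \<alpha>_M[OF t])
  \<comment> \<open>Cyclicity brings the two images under \<open>\<alpha> t\<close> together, as
    \<open>tau_factorizes\<close> requires.\<close>
  also have "\<dots> = tau \<Omega> ((p \<circ> \<alpha> t y') \<circ> \<alpha> t (adj y))"
    by (intro trace M_comp pM \<alpha>_M t y M_adj)
  also have "\<dots> = tau \<Omega> (p \<circ> \<alpha> t (y' \<circ> adj y))"
    by (simp add: \<alpha>_comp[OF t] y M_adj o_assoc)
  also have "\<dots> = tau \<Omega> p * tau \<Omega> (y' \<circ> adj y)"
    by (intro tau_factorizes t p M_comp y M_adj)
  also have "tau \<Omega> (y' \<circ> adj y) = cinner (y \<Omega>) (y' \<Omega>)"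
    using trace[OF y(2) M_adj[OF y(1)]] by (simp add: tau_def cinner_adj_right M_ops y)
  also have "tau \<Omega> p = cinner (x \<Omega>) (x' \<Omega>)"
    by (simp add: p_def tau_def cinner_adj_right M_ops xM)
  finally show ?thesis .
qed

lemma norm_\<alpha>_\<Omega>:
  assumes "t \<ge> 0" "x \<in> M"
  shows "norm (\<alpha> t x \<Omega>) = norm (x \<Omega>)"
  using cinner_factorizes[OF assms(1) rel_commutant_id[OF assms(1)] rel_commutant_id[OF assms(1)] assms(2,2)]
  unfolding cinner_self id_apply norm_\<Omega> by (simp flip: of_real_power)

section \<open>The isometries \<open>S t\<close> as a strongly continuous semigroup\<close>

abbreviation S :: "real \<Rightarrow> 'h \<Rightarrow> 'h" where
  "S \<equiv> canonical_unit M \<Omega> \<alpha>"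

text \<open>Existence and uniqueness behind the definite description: the prescribed map is
  isometric on the dense set of vectors \<open>x \<Omega>\<close> and extends by continuity.\<close>

lemma canonical_unit:
  assumes t: "t \<ge> 0"
  shows "S t \<in> bounded_ops \<and> (\<forall>v. norm (S t v) = norm v) \<and> (\<forall>x\<in>M. S t (x \<Omega>) = \<alpha> t x \<Omega>)"
proof -
  let ?D = "(\<lambda>x. x \<Omega>) ` M"
  \<comment> \<open>Recovers the operator from its vector, which is possible because \<Omega> is
    separating.\<close>
  define r where "r v = (THE x. x \<in> M \<and> x \<Omega> = v)" for v
  have r: "r (x \<Omega>) = x" if "x \<in> M" for x
    unfolding r_def using that separating by blast
  obtain g where g: "g \<in> bounded_ops" "\<And>v. norm (g v) = norm v" "\<And>v. v \<in> ?D \<Longrightarrow> g v = \<alpha> t (r v) \<Omega>"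
  proof (rule isometry_extension[OF dense, of "\<lambda>v. \<alpha> t (r v) \<Omega>"])
    fix v w assume "v \<in> ?D" "w \<in> ?D"
    then obtain x y where xy: "x \<in> M" "v = x \<Omega>" "y \<in> M" "w = y \<Omega>"
      by blast
    show "v + w \<in> ?D" 
      using M_add[OF xy(1,3)] by (auto simp: xy)
    show "\<alpha> t (r (v + w)) \<Omega> = \<alpha> t (r v) \<Omega> + \<alpha> t (r w) \<Omega>"
      using r[OF M_add[OF xy(1,3)]] by (simp add: xy r \<alpha>_add[OF t])
  next
    fix v c assume "v \<in> ?D"
    then obtain x where x: "x \<in> M" "v = x \<Omega>" 
      by blast
    show "c *\<^sub>C v \<in> ?D"
      using M_cscale[OF x(1), of c] by (auto simp: x)
    show "\<alpha> t (r (c *\<^sub>C v)) \<Omega> = c *\<^sub>C \<alpha> t (r v) \<Omega>"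
      using r[OF M_cscale[OF x(1), of c]] by (simp add: x r \<alpha>_cscale[OF t])
    show "norm (\<alpha> t (r v) \<Omega>) = norm v"
      by (simp add: x r norm_\<alpha>_\<Omega>[OF t])
  qed blast
  have "\<exists>!T. T \<in> bounded_ops \<and> (\<forall>v. norm (T v) = norm v) \<and> (\<forall>x\<in>M. T (x \<Omega>) = \<alpha> t x \<Omega>)"
  proof (rule ex1I[of _ g])
    show *: "g \<in> bounded_ops \<and> (\<forall>v. norm (g v) = norm v) \<and> (\<forall>x\<in>M. g (x \<Omega>) = \<alpha> t x \<Omega>)"
      using g by (simp add: r)
    fix T assume "T \<in> bounded_ops \<and> (\<forall>v. norm (T v) = norm v) \<and> (\<forall>x\<in>M. T (x \<Omega>) = \<alpha> t x \<Omega>)"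
    with * show "T = g"
      by (intro bounded_ops_eqI[OF _ _ dense]) auto
  qed
  then show ?thesis
    unfolding canonical_unit_def by (rule theI')
qed

lemma
  assumes "t \<ge> 0"
  shows S_ops: "S t \<in> bounded_ops"
    and norm_S: "norm (S t v) = norm v"
    and S_apply: "x \<in> M \<Longrightarrow> S t (x \<Omega>) = \<alpha> t x \<Omega>"
  using canonical_unit[OF assms] by auto

lemma S_\<Omega>: "t \<ge> 0 \<Longrightarrow> S t \<Omega> = \<Omega>"
  using S_apply[OF _ M_id] by (simp add: \<alpha>_id)

lemma cinner_S: "t \<ge> 0 \<Longrightarrow> cinner (S t v) (S t w) = cinner v w"
  by (rule isometry_cinner[OF S_ops norm_S])

lemma S_zero: "S 0 v = v"
  by (rule dense_induct)
     (auto intro!: closed_Collect_eq bounded_ops_continuous_on S_ops simp: S_apply \<alpha>_zero)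

lemma S_plus:
  assumes "s \<ge> 0" "t \<ge> 0"
  shows "S s (S t v) = S (s + t) v"
proof -
  have "S s \<circ> S t \<in> bounded_ops" "S (s + t) \<in> bounded_ops"
    using assms by (simp_all add: bounded_ops_closed_comp S_ops)
  then have "S s \<circ> S t = S (s + t)"
    by (rule bounded_ops_eqI[OF _ _ dense]) (use assms in \<open>auto simp: S_apply \<alpha>_M \<alpha>_plus\<close>)
  then show ?thesis
    by (simp add: fun_eq_iff)
qed

text \<open>Continuity of \<open>\<alpha>\<close> is only ultraweak, but weak convergence to a
  vector of the same norm is norm convergence, and \<open>S\<close> is isometric. Uniform bounds
  then carry the limit from the vectors \<open>x \<Omega>\<close> to all vectors.\<close>

lemma S_tendsto:
  assumes r: "\<And>n. r n \<ge> 0" "r \<longlonglongrightarrow> 0"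
  shows "(\<lambda>n. S (r n) v) \<longlonglongrightarrow> v"
proof -
  have D: "(\<lambda>n. S (r n) (x \<Omega>)) \<longlonglongrightarrow> x \<Omega>" if x: "x \<in> M" for x
  proof -
    have "continuous_on {0..} (\<lambda>t. cinner (x \<Omega>) (\<alpha> t x \<Omega>))"
      by (rule \<alpha>_continuous[OF x in_predual_cinner])
    then have "(\<lambda>n. cinner (x \<Omega>) (\<alpha> (r n) x \<Omega>)) \<longlonglongrightarrow> cinner (x \<Omega>) (\<alpha> 0 x \<Omega>)"
      using r by (auto simp: continuous_on_sequentially o_def)
    then have lim: "(\<lambda>n. cinner (x \<Omega>) (S (r n) (x \<Omega>))) \<longlonglongrightarrow> cinner (x \<Omega>) (x \<Omega>)"
      by (simp add: \<alpha>_zero x S_apply r(1))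
    have eq: "(norm (S (r n) (x \<Omega>) - x \<Omega>))\<^sup>2
        = 2 * (norm (x \<Omega>))\<^sup>2 - 2 * Re (cinner (x \<Omega>) (S (r n) (x \<Omega>)))" for n
    proof -
      have "(norm (S (r n) (x \<Omega>) - x \<Omega>))\<^sup>2
          = (norm (S (r n) (x \<Omega>)))\<^sup>2 + (norm (x \<Omega>))\<^sup>2 - 2 * inner (x \<Omega>) (S (r n) (x \<Omega>))"
        by (simp add: power2_norm_eq_inner inner_simps inner_commute)
      then show ?thesis
        by (simp add: norm_S r(1) inner_eq_Re_cinner)
    qed
    have "(\<lambda>n. (norm (S (r n) (x \<Omega>) - x \<Omega>))\<^sup>2) \<longlonglongrightarrow> 2 * (norm (x \<Omega>))\<^sup>2 - 2 * Re (cinner (x \<Omega>) (x \<Omega>))"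
      unfolding eq by (intro tendsto_intros lim)
    then have "(\<lambda>n. (norm (S (r n) (x \<Omega>) - x \<Omega>))\<^sup>2) \<longlonglongrightarrow> 0"
      by (simp add: cinner_self)
    from tendsto_real_sqrt[OF this] show ?thesis
      by (simp add: LIM_zero_iff tendsto_norm_zero_iff)
  qed
  have "convergent (\<lambda>n. S (r n) v)" for v
    by (rule Cauchy_convergent, rule bounded_ops_Cauchy_dense[OF dense, where K = 1])
       (auto simp: S_ops norm_S r(1) intro: LIMSEQ_imp_Cauchy D)
  then obtain T where T: "\<And>v. (\<lambda>n. S (r n) v) \<longlonglongrightarrow> T v"
    unfolding convergent_def by metis
  have "norm (T v) = norm v" for v
    using LIMSEQ_unique[OF tendsto_norm[OF T[of v]]] by (simp add: norm_S r(1))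
  moreover have "T (x + y) = T x + T y" "T (c *\<^sub>C x) = c *\<^sub>C T x" for x y c
    using LIMSEQ_unique[OF T[of "x + y"]] tendsto_add[OF T[of x] T[of y]]
      LIMSEQ_unique[OF T[of "c *\<^sub>C x"]] tendsto_cscale[OF T[of x], of c]
    by (simp_all add: bounded_opsD[OF S_ops[OF r(1)]])
  ultimately have "T \<in> bounded_ops"
    by (intro bounded_opsI[where K = 1]) simp_all
  then have "T = id"
    using LIMSEQ_unique[OF T D] by (intro bounded_ops_eqI[OF _ _ dense]) (auto simp: D)
  then show ?thesis
    using T[of v] by simp
qed

text \<open>Approach from below lets \<open>S s\<close> be factored as \<open>S (r n)\<close> after
  \<open>S (s - r n)\<close>, and the isometry \<open>S (r n)\<close> drops out of the norm.\<close>

lemma S_tendsto_joint: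
  assumes r: "\<And>n. r n \<ge> 0" "\<And>n. r n \<le> s" "r \<longlonglongrightarrow> s" and f: "f \<longlonglongrightarrow> v"
  shows "(\<lambda>n. S (r n) (f n)) \<longlonglongrightarrow> S s v"
proof -
  have eq: "S (r n) (f n) - S s v = S (r n) (f n - S (s - r n) v)" for n
    using r(1,2)[of n] by (simp add: bounded_ops_diff[OF S_ops] S_plus)
  have "(\<lambda>n. S (s - r n) v) \<longlonglongrightarrow> v"
    by (rule S_tendsto) (use r in \<open>auto intro!: tendsto_eq_intros\<close>)
  from tendsto_diff[OF f this] have "(\<lambda>n. norm (f n - S (s - r n) v)) \<longlonglongrightarrow> 0"
    by (simp add: tendsto_norm_zero)
  then have "(\<lambda>n. norm (S (r n) (f n) - S s v)) \<longlonglongrightarrow> 0"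
    by (simp add: eq norm_S r(1))
  then show ?thesis
    by (simp add: LIM_zero_iff tendsto_norm_zero_iff)
qed

end

section \<open>Multiplicative functions of a nonnegative real variable\<close>

lemma has_vector_derivative_exp_of_real:
  "((\<lambda>t. exp (c * complex_of_real t)) has_vector_derivative c * exp (c * complex_of_real t)) (at t within S)"
  by (rule has_vector_derivative_real_field) (auto intro!: derivative_eq_intros)

text \<open>A single positive \<open>t\<close> determines the exponent only modulo
  \<open>2 \<pi> \<i> / t\<close>; the one-sided derivative at 0 sees it exactly.\<close>

lemma exp_of_real_inject:
  assumes "\<And>t. t \<ge> 0 \<Longrightarrow> exp (c * complex_of_real t) = exp (d * complex_of_real t)"
  shows "c = d"
proof -
  have "((\<lambda>t. exp (d * complex_of_real t)) has_vector_derivative c * exp (c * complex_of_real 0)) (at 0 within {0..1})"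
    by (rule has_vector_derivative_transform[OF _ _ has_vector_derivative_exp_of_real]) (auto simp: assms)
  then have "c * exp (c * complex_of_real 0) = d * exp (d * complex_of_real 0)"
    by (intro vector_derivative_unique_within_closed_interval[OF _ _ _ has_vector_derivative_exp_of_real, of 0 1])
       auto
  then show ?thesis by simp
qed

text \<open>Integration supplies the missing differentiability: \<open>f\<close> is a difference of
  values of its primitive \<open>F\<close> divided by a constant, hence differentiable, and then
  solves a linear differential equation.\<close>

lemma multiplicative_continuous_imp_exp:
  fixes f :: "real \<Rightarrow> complex"
  assumes cont: "continuous_on {0..} f" and f0: "f 0 = 1"
    and mult: "\<And>s t. s \<ge> 0 \<Longrightarrow> t \<ge> 0 \<Longrightarrow> f (s + t) = f s * f t"
  obtains c where "\<And>t. t \<ge> 0 \<Longrightarrow> f t = exp (c * complex_of_real t)"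
proof -
  define F where "F x = integral {0..x} f" for x
  have F: "(F has_vector_derivative f x) (at x within {0..})" if "x \<ge> 0" for x
  proof -
    have "(F has_vector_derivative f x) (at x within {0..x + 1})"
      unfolding F_def using that
      by (intro integral_has_vector_derivative continuous_on_subset[OF cont]) auto
    moreover have "at x within {0..x + 1} = at x within {0..}"
      by (rule at_within_nhd[of _ "{..<x + 1}"]) auto
    ultimately show ?thesis by simp
  qed
  have shift: "(F has_vector_derivative f (t + x)) (at (t + x) within (+) t ` {0..})"
    if "t \<ge> 0" "x \<ge> 0" for t x
    by (rule has_vector_derivative_within_subset[OF F]) (use that in auto)
  have F_shift: "((\<lambda>x. F (t + x)) has_vector_derivative f (t + x)) (at x within {0..})"
    if "t \<ge> 0" "x \<ge> 0" for t x
  proof -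
    have "((+) t has_vector_derivative 1) (at x within {0..})"
      unfolding has_real_derivative_iff_has_vector_derivative[symmetric]
      by (auto intro!: derivative_eq_intros)
    from vector_diff_chain_within[OF this shift[OF that]] show ?thesis
      by (simp add: o_def)
  qed
  have F0: "F 0 = 0"
    by (simp add: F_def)
  have Fadd: "F (t + x) = F t + f t * F x" if "t \<ge> 0" "x \<ge> 0" for t x
  proof -
    have "((\<lambda>x. F (t + x) - f t * F x) has_vector_derivative 0) (at x within {0..})" if "x \<in> {0..}" for x
      using that \<open>t \<ge> 0\<close> mult[of t x]
      by (auto intro!: derivative_eq_intros F_shift F)
    then obtain k where "\<And>x. x \<in> {0..} \<Longrightarrow> F (t + x) - f t * F x = k"
      using has_vector_derivative_zero_constant[of "{0..}" "\<lambda>x. F (t + x) - f t * F x"] by auto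
    from this[of 0] this[of x] that show ?thesis
      by (simp add: F0 diff_eq_eq)
  qed
  \<comment> \<open>A vanishing primitive would have derivative 0 at 0, against
    \<open>f 0 = 1\<close>; so there is an \<open>F a\<close> to divide by.\<close>
  have "\<exists>a\<ge>0. F a \<noteq> 0"
  proof (rule ccontr)
    assume "\<not> (\<exists>a\<ge>0. F a \<noteq> 0)"
    then have "((\<lambda>_. 0) has_vector_derivative f 0) (at 0 within {0..1})"
      by (intro has_vector_derivative_transform[OF _ _ has_vector_derivative_within_subset[OF F]]) auto
    then have "f 0 = 0"
      by (intro vector_derivative_unique_within_closed_interval[of 0 1 0 "\<lambda>_. 0"]) auto
    then show False
      by (simp add: f0)
  qed
  then obtain a where a: "a \<ge> 0" "F a \<noteq> 0"
    by blast
  define c where "c = (f a - 1) / F a"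
  have f_eq: "f t = (F (a + t) - F t) / F a" if "t \<ge> 0" for t
    using Fadd[OF that a(1)] a(2) by (simp add: add.commute field_simps)
  have f': "(f has_vector_derivative c * f t) (at t within {0..})" if "t \<ge> 0" for t
  proof (rule has_vector_derivative_transform)
    have "((\<lambda>t. (F (a + t) - F t) / F a) has_vector_derivative (f (a + t) - f t) / F a) (at t within {0..})"
      by (intro has_vector_derivative_divide has_vector_derivative_diff F_shift F a that)
    then show "((\<lambda>t. (F (a + t) - F t) / F a) has_vector_derivative c * f t) (at t within {0..})"
      using mult[OF a(1) that] by (simp add: c_def diff_divide_distrib algebra_simps)
  qed (use that f_eq in auto)
  have "((\<lambda>t. f t * exp (- c * complex_of_real t)) has_vector_derivative 0) (at t within {0..})"
    if "t \<in> {0..}" for t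
    using has_vector_derivative_mult[OF f' has_vector_derivative_exp_of_real[of "- c"], of t] that
    by (simp add: algebra_simps)
  then obtain k where k: "\<And>t. t \<in> {0..} \<Longrightarrow> f t * exp (- c * complex_of_real t) = k"
    using has_vector_derivative_zero_constant[of "{0..}" "\<lambda>t. f t * exp (- c * complex_of_real t)"] by auto
  have "k = 1"
    using k[of 0] f0 by simp
  then have "f t = exp (c * complex_of_real t)" if "t \<ge> 0" for t
    using k[of t] that by (simp add: exp_minus field_simps)
  then show thesis by (rule that)
qed

section \<open>Gauge cocycles\<close>

context tracial_E0_semigroup
begin

lemma
  assumes "U \<in> gauge_cocycles M \<alpha>"
  shows gauge_rel_commutant: "t \<ge> 0 \<Longrightarrow> U t \<in> rel_commutant t"
    and gauge_M: "t \<ge> 0 \<Longrightarrow> U t \<in> M"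
    and gauge_unitary: "t \<ge> 0 \<Longrightarrow> unitary (U t)"
    and gauge_continuous: "continuous_on {0..} (\<lambda>t. U t v)"
    and gauge_cocycle: "s \<ge> 0 \<Longrightarrow> t \<ge> 0 \<Longrightarrow> U (s + t) = U s \<circ> \<alpha> s (U t)"
  using assms by (auto simp: gauge_cocycles_def cocycle_def rel_commutant_def)

lemma gauge_adj_cancel:
  assumes "U \<in> gauge_cocycles M \<alpha>" "t \<ge> 0"
  shows "adj (U t) (U t v) = v"
  using gauge_unitary[OF assms] by (simp add: unitary_def fun_eq_iff)

text \<open>The cocycle identity at 0 makes \<open>U 0\<close> idempotent, and an idempotent unitary
  is the identity.\<close>

lemma gauge_zero:
  assumes U: "U \<in> gauge_cocycles M \<alpha>"
  shows "U 0 v = v"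
proof -
  have "U (0 + 0) = U 0 \<circ> \<alpha> 0 (U 0)"
    by (intro gauge_cocycle U) simp_all
  then have "U (0 + 0) v = U 0 (U 0 v)"
    by (simp only: \<alpha>_zero gauge_M[OF U] order_refl o_apply)
  then have "U 0 (U 0 v) = U 0 v"
    by simp
  then show ?thesis
    using gauge_adj_cancel[OF U, of 0 "U 0 v"] gauge_adj_cancel[OF U, of 0 v] by simp
qed

text \<open>\<open>cinner_factorizes\<close> and the cocycle identity make the inner product
  multiplicative in \<open>t\<close>, and strong continuity then makes it exponential. This also
  justifies the definite description in \<open>c_star\<close>.\<close>

lemma gauge_cinner_exp:
  assumes U: "U \<in> gauge_cocycles M \<alpha>" and V: "V \<in> gauge_cocycles M \<alpha>" and t: "t \<ge> 0"
  shows "cinner (U t \<Omega>) (V t \<Omega>) = exp (c_star \<Omega> U V * complex_of_real t)"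
proof -
  define F where "F t = cinner (U t \<Omega>) (V t \<Omega>)" for t
  obtain c where c: "\<And>t. t \<ge> 0 \<Longrightarrow> F t = exp (c * complex_of_real t)"
  proof (rule multiplicative_continuous_imp_exp[of F])
    show "continuous_on {0..} F"
      unfolding F_def by (intro continuous_intros gauge_continuous U V)
    show "F 0 = 1"
      by (simp add: F_def gauge_zero[OF U] gauge_zero[OF V] cinner_\<Omega>)
    show "F (s + t) = F s * F t" if "s \<ge> 0" "t \<ge> 0" for s t
      using cinner_factorizes[OF that(1) gauge_rel_commutant[OF U that(1)] gauge_rel_commutant[OF V that(1)]
          gauge_M[OF U that(2)] gauge_M[OF V that(2)]] that
      by (simp add: F_def gauge_cocycle[OF U] gauge_cocycle[OF V])
  qed blast
  have tau_eq: "tau \<Omega> (adj (U t) \<circ> V t) = F t" if "t \<ge> 0" for t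
    using that by (simp add: tau_def F_def cinner_adj_right M_ops gauge_M[OF U])
  have "c_star \<Omega> U V = c"
    unfolding c_star_def
  proof (rule the_equality)
    fix d assume "\<forall>t\<ge>0. tau \<Omega> (adj (U t) \<circ> V t) = exp (d * complex_of_real t)"
    then have "exp (d * complex_of_real t) = exp (c * complex_of_real t)" if "t \<ge> 0" for t
      using tau_eq[OF that] c[OF that] that by metis
    then show "d = c"
      by (rule exp_of_real_inject)
  qed (simp add: tau_eq c)
  then show ?thesis
    using c[OF t] by (simp add: F_def)
qed

text \<open>The neutral element of the gauge group, restricted because members of
  \<open>gauge_cocycles\<close> are extensional. Pairing it with \<open>U\<close> expresses the
  trace of \<open>U t\<close> through \<open>c_star\<close>.\<close>

definition trivial_cocycle :: "real \<Rightarrow> 'h \<Rightarrow> 'h" where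
  "trivial_cocycle = restrict (\<lambda>_. id) {0..}"

lemma trivial_cocycle_apply: "t \<ge> 0 \<Longrightarrow> trivial_cocycle t = id"
  by (simp add: trivial_cocycle_def)

lemma trivial_cocycle: "trivial_cocycle \<in> gauge_cocycles M \<alpha>"
proof -
  have "unitary (id :: 'h \<Rightarrow> 'h)"
    by (simp add: unitary_def adj_id)
  moreover have "continuous_on {0..} (\<lambda>t. trivial_cocycle t v)" for v
    by (rule continuous_on_eq[OF continuous_on_const[of _ v]]) (simp add: trivial_cocycle_def)
  moreover have "id \<in> commutant (\<alpha> t ` M)" if "t \<ge> 0" for t
    by (rule commutant_id[OF \<alpha>_image_ops[OF that]])
  ultimately show ?thesis
    by (simp add: gauge_cocycles_def cocycle_def M_id \<alpha>_id) (simp add: trivial_cocycle_def M_id \<alpha>_id)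
qed

text \<open>The scalar factor makes the trace of \<open>normal_cocycle U t\<close> equal to 1.\<close>

definition normal_cocycle :: "(real \<Rightarrow> 'h \<Rightarrow> 'h) \<Rightarrow> real \<Rightarrow> 'h \<Rightarrow> 'h" where
  "normal_cocycle U t = (\<lambda>v. exp (- (c_star \<Omega> trivial_cocycle U * complex_of_real t)) *\<^sub>C U t v)"

text \<open>What the increments need from the rescaled family, which in general is no longer unitary
  and so no longer satisfies \<open>cocycle\<close>.\<close>

definition normalized :: "(real \<Rightarrow> 'h \<Rightarrow> 'h) \<Rightarrow> bool" where
  "normalized W \<longleftrightarrow>
     (\<forall>t\<ge>0. W t \<in> rel_commutant t \<and> cinner \<Omega> (W t \<Omega>) = 1) \<and>
     (\<forall>s\<ge>0. \<forall>t\<ge>0. W (s + t) = W s \<circ> \<alpha> s (W t))"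

lemma normalized_normal_cocycle:
  assumes U: "U \<in> gauge_cocycles M \<alpha>"
  shows "normalized (normal_cocycle U)"
  unfolding normalized_def
proof (intro conjI allI impI)
  fix t :: real assume t: "t \<ge> 0"
  show "normal_cocycle U t \<in> rel_commutant t"
    unfolding normal_cocycle_def by (intro rel_commutant_cscale gauge_rel_commutant U t)
  show "cinner \<Omega> (normal_cocycle U t \<Omega>) = 1"
    using gauge_cinner_exp[OF trivial_cocycle U t] t
    by (simp add: normal_cocycle_def cinner_cscale_right trivial_cocycle_apply exp_add[symmetric])
next
  fix s t :: real assume st: "s \<ge> 0" "t \<ge> 0"
  show "normal_cocycle U (s + t) = normal_cocycle U s \<circ> \<alpha> s (normal_cocycle U t)"
  proof
    fix v
    define e where "e t = exp (- (c_star \<Omega> trivial_cocycle U * complex_of_real t))" for t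
    have e: "e (s + t) = e s * e t"
      by (simp add: e_def exp_add[symmetric] algebra_simps)
    have "\<alpha> s (normal_cocycle U t) = (\<lambda>v. e t *\<^sub>C \<alpha> s (U t) v)"
      unfolding normal_cocycle_def e_def by (rule \<alpha>_cscale[OF st(1) gauge_M[OF U st(2)]])
    then have "(normal_cocycle U s \<circ> \<alpha> s (normal_cocycle U t)) v = e s *\<^sub>C U s (e t *\<^sub>C \<alpha> s (U t) v)"
      by (simp add: normal_cocycle_def e_def)
    also have "\<dots> = e (s + t) *\<^sub>C U (s + t) v"
      by (simp add: e gauge_cocycle[OF U st] cscale_cscale bounded_ops_cscale[OF M_ops[OF gauge_M[OF U st(1)]]])
    finally show "normal_cocycle U (s + t) v = (normal_cocycle U s \<circ> \<alpha> s (normal_cocycle U t)) v"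
      by (simp add: normal_cocycle_def e_def)
  qed
qed

lemma cinner_normal_cocycle:
  assumes "U \<in> gauge_cocycles M \<alpha>" "V \<in> gauge_cocycles M \<alpha>" "t \<ge> 0"
  shows "cinner (normal_cocycle U t \<Omega>) (normal_cocycle V t \<Omega>) =
    exp ((c_star \<Omega> U V - cnj (c_star \<Omega> trivial_cocycle U) - c_star \<Omega> trivial_cocycle V) * complex_of_real t)"
  using gauge_cinner_exp[OF assms]
  by (simp add: normal_cocycle_def cinner_cscale_left cinner_cscale_right exp_cnj exp_add[symmetric]
      algebra_simps)

end

section \<open>Semi-inner-product spaces represented in a Hilbert space\<close>

text \<open>A realization of an abstract form by vectors of a genuine Hilbert space. With it,
  positivity and completeness arguments are carried out in the target instead of on the
  records.\<close>

definition represents :: "'v semi_inner_space \<Rightarrow> ('v \<Rightarrow> 'h::chilbert_space) \<Rightarrow> bool" where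
  "represents E D \<longleftrightarrow>
     (\<forall>v\<in>vecs E. \<forall>w\<in>vecs E. vadd E v w \<in> vecs E \<and> D (vadd E v w) = D v + D w) \<and>
     (\<forall>c. \<forall>v\<in>vecs E. vscale E c v \<in> vecs E \<and> D (vscale E c v) = c *\<^sub>C D v) \<and>
     (\<forall>v\<in>vecs E. \<forall>w\<in>vecs E. form E v w = cinner (D v) (D w))"

lemma representsD:
  assumes "represents E D"
  shows "v \<in> vecs E \<Longrightarrow> w \<in> vecs E \<Longrightarrow> vadd E v w \<in> vecs E"
    and "v \<in> vecs E \<Longrightarrow> w \<in> vecs E \<Longrightarrow> D (vadd E v w) = D v + D w"
    and "v \<in> vecs E \<Longrightarrow> vscale E c v \<in> vecs E"
    and "v \<in> vecs E \<Longrightarrow> D (vscale E c v) = c *\<^sub>C D v"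
    and "v \<in> vecs E \<Longrightarrow> w \<in> vecs E \<Longrightarrow> form E v w = cinner (D v) (D w)"
  using assms by (auto simp: represents_def)

lemma represents_vdiff:
  assumes "represents E D" "v \<in> vecs E" "w \<in> vecs E"
  shows "vdiff E v w \<in> vecs E" "D (vdiff E v w) = D v - D w"
  using assms by (simp_all add: vdiff_def representsD cscale_minus_left)

lemma represents_vnorm:
  assumes "represents E D" "v \<in> vecs E"
  shows "vnorm E v = norm (D v)"
  using assms by (simp add: vnorm_def representsD cinner_self)

lemma represents_linear_isometry: "represents E D \<Longrightarrow> linear_isometry E D"
  by (simp add: linear_isometry_def represents_vnorm representsD)

lemma represents_null_rel:
  assumes "represents E D"
  shows "null_rel E = {(v, w). v \<in> vecs E \<and> w \<in> vecs E \<and> D v = D w}"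
  using assms
  by (auto simp: null_rel_def representsD(5) represents_vdiff cinner_eq_zero_iff)

text \<open>Related vectors have the same image, so the arbitrary choice made by
  \<open>some_rep\<close> is invisible to \<open>D\<close>.\<close>

lemma represents_null_quotient:
  assumes E: "represents E D"
  obtains D' where "represents (null_quotient E) D'" "D' ` vecs (null_quotient E) \<subseteq> D ` vecs E"
proof -
  define cls where "cls v = null_rel E `` {v}" for v
  define D' where "D' A = D (some_rep A)" for A
  have rep: "some_rep (cls v) \<in> vecs E" "D (some_rep (cls v)) = D v" if "v \<in> vecs E" for v
  proof -
    have "v \<in> cls v"
      using that by (simp add: cls_def represents_null_rel[OF E])
    then have "some_rep (cls v) \<in> cls v"
      unfolding some_rep_def by (rule someI)
    then show "some_rep (cls v) \<in> vecs E" "D (some_rep (cls v)) = D v"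
      by (auto simp: cls_def represents_null_rel[OF E])
  qed
  have "vecs E // null_rel E = cls ` vecs E"
    by (auto simp: quotient_def cls_def)
  then have nq: "null_quotient E = \<lparr> vecs = cls ` vecs E,
       vadd = (\<lambda>A B. cls (vadd E (some_rep A) (some_rep B))),
       vscale = (\<lambda>c A. cls (vscale E c (some_rep A))),
       form = (\<lambda>A B. form E (some_rep A) (some_rep B)) \<rparr>"
    by (simp add: null_quotient_def cls_def)
  have "represents (null_quotient E) D'"
    by (auto simp: represents_def nq D'_def rep representsD[OF E])
  moreover have "D' ` vecs (null_quotient E) \<subseteq> D ` vecs E"
    by (auto simp: nq D'_def rep)
  ultimately show thesis by (rule that)
qed

text \<open>Abstract distances are distances of images, so a Cauchy sequence has convergent images
  in the complete target; the limit is the new image.\<close>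

lemma represents_cauchy_sequences:
  assumes E: "represents E D"
  obtains D' where "represents (cauchy_sequences E) D'"
    "D' ` vecs (cauchy_sequences E) \<subseteq> closure (D ` vecs E)"
proof -
  define D' where "D' X = lim (\<lambda>n. D (X n))" for X
  have vecs_iff: "X \<in> vecs (cauchy_sequences E) \<longleftrightarrow> (\<forall>n. X n \<in> vecs E) \<and> Cauchy (\<lambda>n. D (X n))" for X
  proof -
    have "vnorm E (vdiff E (X m) (X n)) = dist (D (X m)) (D (X n))" if "\<forall>n. X n \<in> vecs E" for m n
      using that by (simp add: represents_vnorm[OF E] represents_vdiff[OF E] dist_norm)
    then show ?thesis
      by (auto simp: cauchy_sequences_def Cauchy_def)
  qed
  have lim: "(\<lambda>n. D (X n)) \<longlonglongrightarrow> D' X" if "X \<in> vecs (cauchy_sequences E)" for X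
    unfolding D'_def using that Cauchy_convergent convergent_LIMSEQ_iff by (auto simp: vecs_iff)
  have "represents (cauchy_sequences E) D'"
    unfolding represents_def
  proof (intro conjI ballI allI)
    fix X Y assume X: "X \<in> vecs (cauchy_sequences E)" and Y: "Y \<in> vecs (cauchy_sequences E)"
    note XY = X[unfolded vecs_iff, THEN conjunct1, rule_format] Y[unfolded vecs_iff, THEN conjunct1, rule_format]
    have *: "(\<lambda>n. D (vadd E (X n) (Y n))) \<longlonglongrightarrow> D' X + D' Y"
      using tendsto_add[OF lim[OF X] lim[OF Y]] by (simp add: representsD[OF E] XY)
    show "vadd (cauchy_sequences E) X Y \<in> vecs (cauchy_sequences E)"
      unfolding vecs_iff using LIMSEQ_imp_Cauchy[OF *] XY
      by (simp add: cauchy_sequences_def representsD[OF E])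
    show "D' (vadd (cauchy_sequences E) X Y) = D' X + D' Y"
      using limI[OF *] by (simp add: D'_def cauchy_sequences_def)
    have "(\<lambda>n. form E (X n) (Y n)) \<longlonglongrightarrow> cinner (D' X) (D' Y)"
      using tendsto_cinner[OF lim[OF X] lim[OF Y]] by (simp add: representsD[OF E] XY)
    from limI[OF this] show "form (cauchy_sequences E) X Y = cinner (D' X) (D' Y)"
      by (simp add: cauchy_sequences_def)
  next
    fix c X assume X: "X \<in> vecs (cauchy_sequences E)"
    note X' = X[unfolded vecs_iff, THEN conjunct1, rule_format]
    have *: "(\<lambda>n. D (vscale E c (X n))) \<longlonglongrightarrow> c *\<^sub>C D' X"
      using tendsto_cscale[OF lim[OF X]] by (simp add: representsD[OF E] X')
    show "vscale (cauchy_sequences E) c X \<in> vecs (cauchy_sequences E)"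
      unfolding vecs_iff using LIMSEQ_imp_Cauchy[OF *] X'
      by (simp add: cauchy_sequences_def representsD[OF E])
    show "D' (vscale (cauchy_sequences E) c X) = c *\<^sub>C D' X"
      using limI[OF *] by (simp add: D'_def cauchy_sequences_def)
  qed
  moreover have "D' X \<in> closure (D ` vecs E)" if "X \<in> vecs (cauchy_sequences E)" for X
    unfolding closure_sequential using lim[OF that] that
    by (auto simp: vecs_iff intro!: exI[of _ "\<lambda>n. D (X n)"])
  ultimately show thesis
    using that[of D'] by blast
qed

text \<open>Null vectors are divided out before completing and once more among the Cauchy sequences.
  Of these three passages only the middle one can enlarge the image, and only into its
  closure.\<close>

lemma linear_isometry_hilbert_completion:
  assumes "represents E D"
  shows "\<exists>D'. linear_isometry (hilbert_completion (null_quotient E)) D' \<and>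
    D' ` vecs (hilbert_completion (null_quotient E)) \<subseteq> closure (D ` vecs E)"
proof -
  obtain D1 where D1: "represents (null_quotient E) D1" "D1 ` vecs (null_quotient E) \<subseteq> D ` vecs E"
    using represents_null_quotient[OF assms] by blast
  obtain D2 where D2: "represents (cauchy_sequences (null_quotient E)) D2"
    "D2 ` vecs (cauchy_sequences (null_quotient E)) \<subseteq> closure (D1 ` vecs (null_quotient E))"
    using represents_cauchy_sequences[OF D1(1)] by blast
  obtain D3 where D3: "represents (hilbert_completion (null_quotient E)) D3"
    "D3 ` vecs (hilbert_completion (null_quotient E)) \<subseteq> D2 ` vecs (cauchy_sequences (null_quotient E))"
    using represents_null_quotient[OF D2(1)] unfolding hilbert_completion_def by blast
  show ?thesis
    using represents_linear_isometry[OF D3(1)] D3(2) D2(2) closure_mono[OF D1(2)] by blast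
qed

section \<open>Additive cocycles from gauge cocycles\<close>

lemma dyadic_exp_derivative:
  "(\<lambda>n. 2 ^ n * (exp (k * complex_of_real ((1/2) ^ n)) - 1)) \<longlonglongrightarrow> k"
proof -
  have "((\<lambda>z. exp (k * z)) has_field_derivative k) (at 0)"
    by (auto intro!: derivative_eq_intros)
  then have "((\<lambda>h. (exp (k * h) - 1) / h) \<longlongrightarrow> k) (at 0)"
    by (simp add: DERIV_def)
  moreover have "filterlim (\<lambda>n. complex_of_real ((1/2) ^ n)) (at 0) sequentially"
    unfolding filterlim_at by (auto intro!: tendsto_eq_intros LIMSEQ_power_zero)
  ultimately have "(\<lambda>n. (exp (k * complex_of_real ((1/2) ^ n)) - 1) / complex_of_real ((1/2) ^ n)) \<longlonglongrightarrow> k"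
    by (rule filterlim_compose)
  then show ?thesis
    by (simp add: power_one_over field_simps)
qed

text \<open>The extra 1 is the carry of the fractional parts; it causes the single leftover
  increment in the refinement and additivity estimates.\<close>

lemma nat_floor_add:
  assumes "x \<ge> 0" "y \<ge> (0::real)"
  shows "nat \<lfloor>x + y\<rfloor> = nat \<lfloor>x\<rfloor> + nat \<lfloor>y\<rfloor> \<or> nat \<lfloor>x + y\<rfloor> = nat \<lfloor>x\<rfloor> + nat \<lfloor>y\<rfloor> + 1"
  using assms by linarith

definition mesh :: "nat \<Rightarrow> real" where
  "mesh n = (1/2) ^ n"

text \<open>The number of complete mesh cells between 0 and \<open>t\<close>. Rounding down keeps
  the Riemann sums inside the gauge algebra of time \<open>t\<close>.\<close>

definition steps :: "nat \<Rightarrow> real \<Rightarrow> nat" where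
  "steps n t = nat \<lfloor>t * 2 ^ n\<rfloor>"

lemma mesh_nonneg: "mesh n \<ge> 0"
  by (simp add: mesh_def)

lemma mesh_Suc: "mesh n = 2 * mesh (Suc n)"
  by (simp add: mesh_def)

lemma steps_mesh_le: "t \<ge> 0 \<Longrightarrow> real (steps n t) * mesh n \<le> t"
  and steps_mesh_ge: "t \<ge> 0 \<Longrightarrow> t - mesh n \<le> real (steps n t) * mesh n"
proof -
  assume t: "t \<ge> 0"
  have "real (steps n t) \<le> t * 2 ^ n" "t * 2 ^ n - 1 \<le> real (steps n t)"
    unfolding steps_def using t by (simp_all add: of_nat_nat)
  from mult_right_mono[OF this(1) mesh_nonneg[of n]] mult_right_mono[OF this(2) mesh_nonneg[of n]]
  show "real (steps n t) * mesh n \<le> t" "t - mesh n \<le> real (steps n t) * mesh n"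
    by (simp_all add: mesh_def power_one_over field_simps)
qed

lemma steps_mesh_tendsto:
  assumes "t \<ge> 0"
  shows "(\<lambda>n. real (steps n t) * mesh n) \<longlonglongrightarrow> t"
proof (rule tendsto_sandwich[of "\<lambda>n. t - mesh n" _ _ "\<lambda>_. t"])
  show "(\<lambda>n. t - mesh n) \<longlonglongrightarrow> t"
    unfolding mesh_def by (auto intro!: tendsto_eq_intros LIMSEQ_power_zero)
qed (use steps_mesh_le steps_mesh_ge assms in auto)

lemma steps_add:
  assumes "s \<ge> 0" "t \<ge> 0"
  shows "steps n (s + t) = steps n s + steps n t \<or> steps n (s + t) = steps n s + steps n t + 1"
  using nat_floor_add[of "s * 2 ^ n" "t * 2 ^ n"] assms by (simp add: steps_def distrib_right)

lemma steps_Suc: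
  assumes "t \<ge> 0"
  shows "steps (Suc n) t = 2 * steps n t \<or> steps (Suc n) t = 2 * steps n t + 1"
  using nat_floor_add[of "t * 2 ^ n" "t * 2 ^ n"] assms
  unfolding steps_def power_Suc mult_2 distrib_left by simp

context tracial_E0_semigroup
begin

subsection \<open>Sums of shifted increments\<close>

definition shift_sum :: "real \<Rightarrow> 'h \<Rightarrow> nat \<Rightarrow> 'h" where
  "shift_sum h \<zeta> N = (\<Sum>i<N. S (real i * h) \<zeta>)"

lemma shift_sum_Suc: "shift_sum h \<zeta> (Suc N) = shift_sum h \<zeta> N + S (real N * h) \<zeta>"
  and shift_sum_zero: "shift_sum h \<zeta> 0 = 0"
  by (simp_all add: shift_sum_def)

text \<open>The additive cocycle identity at the level of sums; with \<open>m = 1\<close> it also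
  splits off the first summand.\<close>

lemma shift_sum_add:
  assumes "h \<ge> 0"
  shows "shift_sum h \<zeta> (m + n) = shift_sum h \<zeta> m + S (real m * h) (shift_sum h \<zeta> n)"
proof (induction n)
  case 0
  then show ?case
    using assms by (simp add: shift_sum_zero bounded_ops_zero[OF S_ops])
next
  case (Suc n)
  have "S (real m * h) (S (real n * h) \<zeta>) = S (real (m + n) * h) \<zeta>"
    using assms by (simp add: S_plus distrib_right)
  with Suc show ?case
    using assms by (simp add: shift_sum_Suc bounded_ops_add[OF S_ops])
qed

lemma shift_sum_diff:
  assumes "h \<ge> 0"
  shows "shift_sum h (\<zeta> - \<eta>) N = shift_sum h \<zeta> N - shift_sum h \<eta> N"
  using assms by (simp add: shift_sum_def bounded_ops_diff[OF S_ops] sum_subtractf)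

text \<open>Consecutive summands are paired, so that the sum over the halved mesh can be compared
  with the coarse one term by term.\<close>

lemma shift_sum_double:
  assumes "h \<ge> 0"
  shows "shift_sum h \<zeta> (2 * N) = shift_sum (2 * h) (\<zeta> + S h \<zeta>) N"
proof (induction N)
  case (Suc N)
  have "S (real N * (2 * h)) (S h \<zeta>) = S ((2 * real N + 1) * h) \<zeta>"
    using assms by (simp add: S_plus algebra_simps)
  with Suc show ?case
    using assms by (simp add: shift_sum_Suc bounded_ops_add[OF S_ops] mult_ac add_ac)
qed (simp add: shift_sum_zero)

text \<open>Both vectors are orthogonal to the range of \<open>S h\<close>, so their shifted copies
  behave as in a Wold decomposition and only diagonal terms survive.\<close>

lemma cinner_shift_sum:
  assumes h: "h \<ge> 0" and \<zeta>: "\<And>v. cinner \<zeta> (S h v) = 0" and \<eta>: "\<And>v. cinner \<eta> (S h v) = 0"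
  shows "cinner (shift_sum h \<zeta> N) (shift_sum h \<eta> N) = of_nat N * cinner \<zeta> \<eta>"
proof (induction N)
  case (Suc N)
  \<comment> \<open>The first summand is split off rather than the last: the remainder then lies in
    the range of \<open>S h\<close>.\<close>
  have "shift_sum h \<theta> (Suc N) = \<theta> + S h (shift_sum h \<theta> N)" for \<theta>
    using shift_sum_add[OF h, of \<theta> 1 N] by (simp add: shift_sum_def S_zero)
  moreover have "cinner (S h v) \<eta> = 0" for v
    using \<eta>[of v] cinner_commute[of "S h v" \<eta>] by simp
  ultimately show ?case
    using Suc by (simp add: cinner_add_left cinner_add_right \<zeta> cinner_S[OF h] distrib_right)
qed (simp add: shift_sum_zero)

lemma norm_shift_sum:
  assumes "h \<ge> 0" "\<And>v. cinner \<zeta> (S h v) = 0"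
  shows "(norm (shift_sum h \<zeta> N))\<^sup>2 = real N * (norm \<zeta>)\<^sup>2"
proof -
  have "complex_of_real ((norm (shift_sum h \<zeta> N))\<^sup>2) = complex_of_real (real N * (norm \<zeta>)\<^sup>2)"
    using cinner_shift_sum[OF assms(1,2,2)] unfolding cinner_self by simp
  then show ?thesis
    by (simp only: of_real_eq_iff)
qed

subsection \<open>Increments\<close>

definition increment :: "(real \<Rightarrow> 'h \<Rightarrow> 'h) \<Rightarrow> real \<Rightarrow> 'h" where
  "increment U t = normal_cocycle U t \<Omega> - \<Omega>"

text \<open>\<open>c_star\<close> based at the trivial cocycle: the usual passage from a
  conditionally positive kernel to a positive one.\<close>

definition reduced_c :: "(real \<Rightarrow> 'h \<Rightarrow> 'h) \<Rightarrow> (real \<Rightarrow> 'h \<Rightarrow> 'h) \<Rightarrow> complex" where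
  "reduced_c U V = c_star \<Omega> U V - cnj (c_star \<Omega> trivial_cocycle U) - c_star \<Omega> trivial_cocycle V"

context
  fixes U
  assumes U: "U \<in> gauge_cocycles M \<alpha>"
begin

lemma
  assumes "t \<ge> 0"
  shows normal_cocycle_rel_commutant: "normal_cocycle U t \<in> rel_commutant t"
    and cinner_\<Omega>_normal_cocycle: "cinner \<Omega> (normal_cocycle U t \<Omega>) = 1"
    and cinner_normal_cocycle_\<Omega>: "cinner (normal_cocycle U t \<Omega>) \<Omega> = 1"
proof -
  show "normal_cocycle U t \<in> rel_commutant t" and *: "cinner \<Omega> (normal_cocycle U t \<Omega>) = 1"
    using normalized_normal_cocycle[OF U] assms by (simp_all add: normalized_def)
  show "cinner (normal_cocycle U t \<Omega>) \<Omega> = 1"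
    using * cinner_commute[of "normal_cocycle U t \<Omega>" \<Omega>] by simp
qed

lemma normal_cocycle_M: "t \<ge> 0 \<Longrightarrow> normal_cocycle U t \<in> M"
  by (rule rel_commutant_M[OF normal_cocycle_rel_commutant])

lemma normal_cocycle_cocycle:
  "s \<ge> 0 \<Longrightarrow> t \<ge> 0 \<Longrightarrow> normal_cocycle U (s + t) = normal_cocycle U s \<circ> \<alpha> s (normal_cocycle U t)"
  using normalized_normal_cocycle[OF U] by (simp add: normalized_def)

text \<open>Realizes the increment by an operator commuting with the range of
  \<open>\<alpha> t\<close>, as \<open>cinner_factorizes\<close> demands; it is centred because
  \<open>normal_cocycle U t\<close> has trace 1.\<close>

lemma increment_op:
  assumes t: "t \<ge> 0"
  defines "w \<equiv> \<lambda>v. normal_cocycle U t v - v"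
  shows "w \<in> rel_commutant t" "w \<Omega> = increment U t" "\<alpha> t w = (\<lambda>v. \<alpha> t (normal_cocycle U t) v - v)"
    "cinner (increment U t) \<Omega> = 0" "cinner \<Omega> (increment U t) = 0"
proof -
  \<comment> \<open>The endomorphism laws speak of sums and scalar multiples, so the difference is
    written with the factor -1.\<close>
  have w: "w = (\<lambda>v. normal_cocycle U t v + (-1) *\<^sub>C id v)"
    by (simp add: w_def cscale_minus_left)
  show "w \<in> rel_commutant t"
    unfolding w by (intro rel_commutant_add rel_commutant_cscale rel_commutant_id normal_cocycle_rel_commutant t)
  show "w \<Omega> = increment U t"
    by (simp add: w_def increment_def)
  show "\<alpha> t w = (\<lambda>v. \<alpha> t (normal_cocycle U t) v - v)"
    unfolding w \<alpha>_add[OF t normal_cocycle_M[OF t] M_cscale[OF M_id]] \<alpha>_cscale[OF t M_id]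
    by (simp add: \<alpha>_id[OF t] cscale_minus_left)
  show "cinner (increment U t) \<Omega> = 0" "cinner \<Omega> (increment U t) = 0"
    by (simp_all add: increment_def cinner_diff_left cinner_diff_right cinner_\<Omega> t
      cinner_\<Omega>_normal_cocycle cinner_normal_cocycle_\<Omega>)
qed

text \<open>By \<open>cinner_factorizes\<close> the inner product with
  \<open>\<alpha> t y \<Omega>\<close> contains the factor
  \<open>cinner (increment U t) \<Omega>\<close>, which is 0.\<close>

lemma increment_orthogonal:
  assumes t: "t \<ge> 0"
  shows "cinner (increment U t) (S t v) = 0"
proof (rule dense_induct[where P = "\<lambda>v. cinner (increment U t) (S t v) = 0"])
  show "closed {v. cinner (increment U t) (S t v) = 0}"
    by (intro closed_Collect_eq continuous_intros bounded_ops_continuous_on S_ops t)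
  show "cinner (increment U t) (S t (y \<Omega>)) = 0" if "y \<in> M" for y
    using cinner_factorizes[OF t increment_op(1)[OF t] rel_commutant_id[OF t] M_id that]
    by (simp add: S_apply[OF t that] \<alpha>_id[OF t] increment_op(4)[OF t] flip: increment_def)
qed

text \<open>Doubling the mesh changes the increment by \<open>(W t - 1) \<alpha> t (W t - 1) \<Omega>\<close> with
  \<open>W = normal_cocycle U\<close>; this is of second order by the factorization of the trace.\<close>

lemma increment_double:
  assumes t: "t \<ge> 0"
  defines "\<delta> \<equiv> increment U (2 * t) - (increment U t + S t (increment U t))"
  shows "norm \<delta> = (norm (increment U t))\<^sup>2" and "cinner \<delta> (S (2 * t) v) = 0"
proof -
  define w where "w = (\<lambda>v. normal_cocycle U t v - v)"
  note w = increment_op[OF t, folded w_def]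
  have w_apply: "w v = normal_cocycle U t v - v" for v
    by (simp add: w_def)
  have w_\<Omega>: "w \<Omega> = increment U t"
    by (simp add: w_apply increment_def)
  note W = normal_cocycle_M[OF t]
  have "normal_cocycle U (2 * t) = normal_cocycle U t \<circ> \<alpha> t (normal_cocycle U t)"
    using normal_cocycle_cocycle[OF t t] by simp
  then have \<delta>: "\<delta> = w (\<alpha> t w \<Omega>)"
    by (simp add: \<delta>_def w(3) increment_def w_apply bounded_ops_diff[OF M_ops[OF W]] S_apply[OF t W]
      bounded_ops_diff[OF S_ops[OF t]] S_\<Omega>[OF t])
  have "cinner \<delta> \<delta> = cinner (increment U t) (increment U t) * cinner (increment U t) (increment U t)"
    unfolding \<delta> w_\<Omega>[symmetric]
    by (intro cinner_factorizes t w(1) rel_commutant_M[OF w(1)])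
  then have "complex_of_real ((norm \<delta>)\<^sup>2) = complex_of_real (((norm (increment U t))\<^sup>2)\<^sup>2)"
    by (simp add: cinner_self power2_eq_square)
  then show "norm \<delta> = (norm (increment U t))\<^sup>2"
    unfolding of_real_eq_iff by (rule power2_eq_imp_eq) simp_all
  show "cinner \<delta> (S (2 * t) v) = 0"
  proof (rule dense_induct[where P = "\<lambda>v. cinner \<delta> (S (2 * t) v) = 0"])
    show "closed {v. cinner \<delta> (S (2 * t) v) = 0}"
      by (intro closed_Collect_eq continuous_intros bounded_ops_continuous_on S_ops) (use t in simp)
    fix y assume y: "y \<in> M"
    \<comment> \<open>Splitting the time \<open>2 * t\<close> in two puts the vector in the range of
      \<open>\<alpha> t\<close>; the factor \<open>cinner (w \<Omega>) \<Omega>\<close> then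
      vanishes.\<close>
    have "S (2 * t) (y \<Omega>) = id (\<alpha> t (\<alpha> t y) \<Omega>)"
      using t y by (simp add: S_apply \<alpha>_plus)
    then have "cinner \<delta> (S (2 * t) (y \<Omega>)) = cinner (w \<Omega>) (id \<Omega>) * cinner (w \<Omega>) (\<alpha> t y \<Omega>)"
      unfolding \<delta>
      by (simp only: cinner_factorizes[OF t w(1) rel_commutant_id[OF t] rel_commutant_M[OF w(1)] \<alpha>_M[OF t y]])
    then show "cinner \<delta> (S (2 * t) (y \<Omega>)) = 0"
      by (simp add: w_\<Omega> w(4))
  qed
qed

end

lemma cinner_increment:
  assumes U: "U \<in> gauge_cocycles M \<alpha>" and V: "V \<in> gauge_cocycles M \<alpha>" and t: "t \<ge> 0"
  shows "cinner (increment U t) (increment V t) = exp (reduced_c U V * complex_of_real t) - 1"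
  using cinner_normal_cocycle[OF U V t]
  by (simp add: increment_def reduced_c_def cinner_diff_left cinner_diff_right cinner_\<Omega>
      cinner_\<Omega>_normal_cocycle[OF V t] cinner_normal_cocycle_\<Omega>[OF U t])

section \<open>Gauge algebras and dyadic Riemann sums\<close>

lemma
  shows gauge_algebra_generator: "U \<in> gauge_cocycles M \<alpha> \<Longrightarrow> 0 \<le> s \<Longrightarrow> s \<le> t \<Longrightarrow> U s \<in> gauge_algebra M \<alpha> t"
    and gauge_algebra_id: "id \<in> gauge_algebra M \<alpha> t"
    and gauge_algebra_add: "x \<in> gauge_algebra M \<alpha> t \<Longrightarrow> y \<in> gauge_algebra M \<alpha> t \<Longrightarrow>
      (\<lambda>v. x v + y v) \<in> gauge_algebra M \<alpha> t"
    and gauge_algebra_cscale: "x \<in> gauge_algebra M \<alpha> t \<Longrightarrow> (\<lambda>v. c *\<^sub>C x v) \<in> gauge_algebra M \<alpha> t"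
    and gauge_algebra_comp: "x \<in> gauge_algebra M \<alpha> t \<Longrightarrow> y \<in> gauge_algebra M \<alpha> t \<Longrightarrow>
      x \<circ> y \<in> gauge_algebra M \<alpha> t"
    and gauge_algebra_adj: "x \<in> gauge_algebra M \<alpha> t \<Longrightarrow> adj x \<in> gauge_algebra M \<alpha> t"
  unfolding gauge_algebra_def vn_generated_def
  by (auto simp: vn_id vn_add vn_cscale vn_comp vn_adj)

definition approx :: "(real \<Rightarrow> 'h \<Rightarrow> 'h) \<Rightarrow> nat \<Rightarrow> real \<Rightarrow> 'h" where
  "approx U n t = shift_sum (mesh n) (increment U (mesh n)) (steps n t)"

definition additive_part :: "(real \<Rightarrow> 'h \<Rightarrow> 'h) \<Rightarrow> real \<Rightarrow> 'h" where
  "additive_part U t = lim (\<lambda>n. approx U n t)"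

text \<open>With N steps of length h, \<open>N (exp (k h) - 1)\<close> is \<open>N h\<close>,
  tending to \<open>t\<close>, times a difference quotient of the exponential at 0, tending to
  \<open>k\<close>.\<close>

lemma cinner_approx_tendsto:
  assumes U: "U \<in> gauge_cocycles M \<alpha>" and V: "V \<in> gauge_cocycles M \<alpha>" and t: "t \<ge> 0"
  shows "(\<lambda>n. cinner (approx U n t) (approx V n t)) \<longlonglongrightarrow> complex_of_real t * reduced_c U V"
proof -
  have "cinner (approx U n t) (approx V n t) =
      complex_of_real (real (steps n t) * mesh n) * (2 ^ n * (exp (reduced_c U V * complex_of_real ((1/2) ^ n)) - 1))" for n
    using cinner_shift_sum[OF mesh_nonneg increment_orthogonal[OF U mesh_nonneg] increment_orthogonal[OF V mesh_nonneg]]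
      cinner_increment[OF U V mesh_nonneg]
    by (simp add: approx_def) (simp add: mesh_def power_one_over field_simps)
  then show ?thesis
    by (simp only:) (intro tendsto_mult tendsto_of_real steps_mesh_tendsto t dyadic_exp_derivative)
qed

context
  fixes U
  assumes U: "U \<in> gauge_cocycles M \<alpha>"
begin

text \<open>The squared norm is \<open>exp (k h) - 1\<close> with \<open>k = reduced_c U U\<close>,
  and convergent difference quotients are bounded.\<close>

lemma increment_mesh_bound:
  obtains C where "C \<ge> 0" "\<And>n. (norm (increment U (mesh n)))\<^sup>2 \<le> C * mesh n"
proof -
  have "Bseq (\<lambda>n. 2 ^ n * (exp (reduced_c U U * complex_of_real ((1/2) ^ n)) - 1))"
    using dyadic_exp_derivative by (intro convergent_imp_Bseq convergentI)
  then obtain C where C: "C > 0" "\<And>n. cmod (2 ^ n * (exp (reduced_c U U * complex_of_real ((1/2) ^ n)) - 1)) \<le> C"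
    unfolding Bseq_def by blast
  have "(norm (increment U (mesh n)))\<^sup>2 \<le> C * mesh n" for n
  proof -
    have "(norm (increment U (mesh n)))\<^sup>2 = cmod (cinner (increment U (mesh n)) (increment U (mesh n)))"
      by (simp add: cinner_self norm_power)
    also have "\<dots> = cmod (exp (reduced_c U U * complex_of_real ((1/2) ^ n)) - 1)"
      by (subst cinner_increment[OF U U mesh_nonneg]) (simp only: mesh_def)
    also have "\<dots> \<le> C * mesh n"
      using C(2)[of n] unfolding norm_mult norm_power by (simp add: mesh_def power_one_over field_simps)
    finally show ?thesis .
  qed
  then show thesis
    using that C(1) by (meson less_imp_le)
qed

lemma increment_mesh_tendsto: "(\<lambda>n. increment U (mesh n)) \<longlonglongrightarrow> 0"
proof -
  obtain C where C: "C \<ge> 0" "\<And>n. (norm (increment U (mesh n)))\<^sup>2 \<le> C * mesh n"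
    using increment_mesh_bound by blast
  have "(\<lambda>n. C * mesh n) \<longlonglongrightarrow> 0"
    unfolding mesh_def by (auto intro!: tendsto_eq_intros LIMSEQ_power_zero)
  then have "(\<lambda>n. (norm (increment U (mesh n)))\<^sup>2) \<longlonglongrightarrow> 0"
    by (rule tendsto_sandwich[OF _ _ tendsto_const, rotated -1]) (use C in auto)
  from tendsto_real_sqrt[OF this] show ?thesis
    by (simp add: tendsto_norm_zero_iff)
qed

text \<open>There are two errors. Refinement produces N orthogonal corrections, whence sqrt N
  instead of N; rounding may add one fine increment.\<close>

lemma approx_step:
  assumes "t \<ge> 0"
  shows "norm (approx U (Suc n) t - approx U n t) \<le>
    sqrt (real (steps n t)) * (norm (increment U (mesh (Suc n))))\<^sup>2 + norm (increment U (mesh (Suc n)))"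
proof -
  define k where "k = mesh (Suc n)"
  have k: "k \<ge> 0" "mesh n = 2 * k"
    unfolding k_def by (simp_all add: mesh_nonneg flip: mesh_Suc)
  define N where "N = steps n t"
  define \<delta> where "\<delta> = increment U (2 * k) - (increment U k + S k (increment U k))"
  note \<delta> = increment_double[OF U k(1), folded \<delta>_def]
  have "approx U n t - shift_sum k (increment U k) (2 * N) = shift_sum (2 * k) \<delta> N"
    using k by (simp add: approx_def N_def \<delta>_def shift_sum_double shift_sum_diff)
  moreover have "norm (shift_sum (2 * k) \<delta> N) = sqrt (real N) * (norm (increment U k))\<^sup>2"
  proof -
    have "(norm (shift_sum (2 * k) \<delta> N))\<^sup>2 = real N * (norm \<delta>)\<^sup>2"
      by (rule norm_shift_sum[OF _ \<delta>(2)]) (use k in simp)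
    then have "norm (shift_sum (2 * k) \<delta> N) = sqrt (real N * (norm \<delta>)\<^sup>2)"
      by (metis norm_ge_zero real_sqrt_unique)
    then show ?thesis
      by (simp only: real_sqrt_mult real_sqrt_abs) (simp add: \<delta>(1))
  qed
  ultimately have 1: "norm (shift_sum k (increment U k) (2 * N) - approx U n t) = sqrt (real N) * (norm (increment U k))\<^sup>2"
    by (metis norm_minus_commute)
  have 2: "norm (approx U (Suc n) t - shift_sum k (increment U k) (2 * N)) \<le> norm (increment U k)"
    using steps_Suc[OF assms, of n] k(1)
    by (auto simp: approx_def N_def shift_sum_Suc norm_S simp flip: k_def)
  show ?thesis
    using norm_triangle_ineq[of "approx U (Suc n) t - shift_sum k (increment U k) (2 * N)"
        "shift_sum k (increment U k) (2 * N) - approx U n t"] 1 2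
    by (simp add: N_def k_def)
qed

text \<open>With \<open>N h\<close> at most \<open>t\<close> and squared increments at most
  \<open>C h\<close>, both terms of \<open>approx_step\<close> are of order sqrt h, so consecutive
  approximations differ by a summable geometric bound.\<close>

lemma approx_tendsto:
  assumes t: "t \<ge> 0"
  shows "(\<lambda>n. approx U n t) \<longlonglongrightarrow> additive_part U t"
proof -
  obtain C where C: "C \<ge> 0" "\<And>n. (norm (increment U (mesh n)))\<^sup>2 \<le> C * mesh n"
    using increment_mesh_bound by blast
  \<comment> \<open>The square root of the mesh ratio, so that \<open>mesh n\<close> is the square
    of \<open>r ^ n\<close>.\<close>
  define r where "r = sqrt (1/2)"
  have r2: "r * r = 1/2" and r: "0 \<le> r" "r < 1"
    by (simp_all add: r_def)
  have mesh_r: "mesh n = r ^ n * r ^ n" for n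
    by (simp add: mesh_def r2 flip: power_mult_distrib)
  have bound: "norm (approx U (Suc n) t - approx U n t) \<le> (sqrt t * C + sqrt C) * r ^ n" for n
  proof -
    define x where "x = norm (increment U (mesh (Suc n)))"
    have "mesh (Suc n) \<le> mesh n"
      by (simp add: mesh_def)
    then have x2: "x\<^sup>2 \<le> C * mesh n"
      using order_trans[OF C(2)[of "Suc n"] mult_left_mono[OF _ C(1)]] by (simp add: x_def)
    then have "sqrt (x\<^sup>2) \<le> sqrt (C * mesh n)"
      by (rule real_sqrt_le_mono)
    then have x1: "x \<le> sqrt C * r ^ n"
      using r by (simp add: x_def real_sqrt_mult mesh_r)
    have "real (steps n t) * (r ^ n * r ^ n) \<le> t"
      using steps_mesh_le[OF t, of n] by (simp add: mesh_r)
    then have "sqrt (real (steps n t) * (r ^ n * r ^ n)) \<le> sqrt t"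
      by (rule real_sqrt_le_mono)
    then have st: "sqrt (real (steps n t)) * r ^ n \<le> sqrt t"
      using r by (simp add: real_sqrt_mult)
    have "sqrt (real (steps n t)) * x\<^sup>2 \<le> sqrt (real (steps n t)) * (C * mesh n)"
      by (intro mult_left_mono x2) simp
    also have "\<dots> = (sqrt (real (steps n t)) * r ^ n) * (C * r ^ n)"
      by (simp add: mesh_r mult_ac)
    also have "\<dots> \<le> sqrt t * (C * r ^ n)"
      using C(1) r by (intro mult_right_mono st) auto
    finally have "sqrt (real (steps n t)) * x\<^sup>2 + x \<le> (sqrt t * C + sqrt C) * r ^ n"
      using x1 by (simp add: algebra_simps)
    with approx_step[OF t, of n] show ?thesis
      by (simp add: x_def)
  qed
  have "summable (\<lambda>n. (sqrt t * C + sqrt C) * r ^ n)"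
    using r by (intro summable_mult summable_geometric) simp
  then have "summable (\<lambda>n. approx U (Suc n) t - approx U n t)"
    by (rule summable_comparison_test'[where N = 0]) (rule bound)
  then have "convergent (\<lambda>n. \<Sum>i<n. approx U (Suc i) t - approx U i t)"
    by (simp add: summable_iff_convergent)
  then have "convergent (\<lambda>n. (approx U n t - approx U 0 t) + approx U 0 t)"
    by (intro convergent_add convergent_const) (simp only: sum_lessThan_telescope[of "\<lambda>i. approx U i t"])
  then show ?thesis
    by (simp add: additive_part_def convergent_LIMSEQ_iff)
qed

text \<open>At mesh level the identity fails by at most one increment, which tends to 0. The shift
  there is by the rounded time \<open>r n\<close>, which approaches \<open>s\<close> from below as
  \<open>S_tendsto_joint\<close> requires.\<close>

lemma additive_part_add:
  assumes s: "s \<ge> 0" and t: "t \<ge> 0"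
  shows "additive_part U (s + t) = additive_part U s + S s (additive_part U t)"
proof -
  define r where "r n = real (steps n s) * mesh n" for n
  have r: "r n \<ge> 0" "r n \<le> s" "r \<longlonglongrightarrow> s" for n
    using steps_mesh_le[OF s] steps_mesh_tendsto[OF s] mesh_nonneg by (simp_all add: r_def[abs_def])
  have "norm (approx U n (s + t) - (approx U n s + S (r n) (approx U n t))) \<le> norm (increment U (mesh n))" for n
    using steps_add[OF s t, of n] shift_sum_add[OF mesh_nonneg, of n "increment U (mesh n)" "steps n s" "steps n t"]
    by (auto simp: approx_def r_def shift_sum_Suc norm_S mesh_nonneg)
  then have "(\<lambda>n. approx U n (s + t) - (approx U n s + S (r n) (approx U n t))) \<longlonglongrightarrow> 0"
    by (intro Lim_null_comparison[OF always_eventually tendsto_norm_zero[OF increment_mesh_tendsto]]) blast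
  moreover have "(\<lambda>n. approx U n (s + t) - (approx U n s + S (r n) (approx U n t))) \<longlonglongrightarrow>
      additive_part U (s + t) - (additive_part U s + S s (additive_part U t))"
    by (intro tendsto_diff tendsto_add approx_tendsto S_tendsto_joint r) (use s t in auto)
  ultimately show ?thesis
    using LIMSEQ_unique by fastforce
qed

text \<open>Convergence for \<open>V\<close> is a hypothesis since \<open>approx_tendsto\<close> is
  available here only for the fixed \<open>U\<close>. Taking \<open>V = U\<close> gives the
  norm.\<close>

lemma cinner_additive_part:
  assumes V: "V \<in> gauge_cocycles M \<alpha>" and t: "t \<ge> 0" and lim: "(\<lambda>n. approx V n t) \<longlonglongrightarrow> v"
  shows "cinner (additive_part U t) v = complex_of_real t * reduced_c U V"
  by (rule LIMSEQ_unique[OF tendsto_cinner[OF approx_tendsto[OF t] lim] cinner_approx_tendsto[OF U V t]])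

text \<open>Additivity and isometry reduce the distance between two times to the norm at their
  difference, the square root of a linear function. Continuity supplies the measurability of an
  additive cocycle.\<close>

lemma continuous_additive_part: "continuous_on {0..} (additive_part U)"
proof -
  have norm: "norm (additive_part U t) = sqrt (t * Re (reduced_c U U))" if "t \<ge> 0" for t
  proof -
    have "complex_of_real ((norm (additive_part U t))\<^sup>2) = complex_of_real t * reduced_c U U"
      using cinner_additive_part[OF U that approx_tendsto[OF that]] by (simp only: cinner_self)
    from arg_cong[OF this, of Re] have "(norm (additive_part U t))\<^sup>2 = t * Re (reduced_c U U)"
      by simp
    then show ?thesis
      by (metis norm_ge_zero real_sqrt_unique)
  qed
  have ord: "dist (additive_part U t) (additive_part U s) = sqrt (\<bar>t - s\<bar> * Re (reduced_c U U))"
    if "0 \<le> s" "s \<le> t" for s t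
    using additive_part_add[of s "t - s"] norm[of "t - s"] that by (simp add: dist_norm norm_S)
  have dist: "dist (additive_part U t) (additive_part U s) = sqrt (\<bar>t - s\<bar> * Re (reduced_c U U))"
    if "0 \<le> s" "0 \<le> t" for s t
    using ord[of s t] ord[of t s] that by (cases "s \<le> t") (auto simp: dist_commute abs_minus_commute)
  show ?thesis
    unfolding continuous_on_def
  proof
    fix s :: real assume s: "s \<in> {0..}"
    have "((\<lambda>t. sqrt (\<bar>t - s\<bar> * Re (reduced_c U U))) \<longlongrightarrow> 0) (at s within {0..})"
      by (auto intro!: tendsto_eq_intros)
    moreover have "\<forall>\<^sub>F t in at s within {0..}. sqrt (\<bar>t - s\<bar> * Re (reduced_c U U)) = dist (additive_part U t) (additive_part U s)"
      unfolding eventually_at_filter using s dist by (auto intro!: always_eventually)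
    ultimately show "(additive_part U \<longlongrightarrow> additive_part U s) (at s within {0..})"
      unfolding tendsto_dist_iff[of "additive_part U"] by (rule Lim_transform_eventually)
  qed
qed

subsection \<open>Membership in the gauge spaces\<close>

text \<open>The cocycle identity rewrites \<open>\<alpha> s (U h)\<close> as
  \<open>adj (U s)\<close> times \<open>U (s + h)\<close>, and both times are at most
  \<open>t\<close>.\<close>

lemma shifted_increment_in_gauge_algebra:
  assumes "s \<ge> 0" "h \<ge> 0" "s + h \<le> t"
  shows "\<exists>x\<in>gauge_algebra M \<alpha> t. S s (increment U h) = x \<Omega>"
proof -
  define e where "e = exp (- (c_star \<Omega> trivial_cocycle U * complex_of_real h))"
  define x where "x = (\<lambda>v. e *\<^sub>C (adj (U s) \<circ> U (s + h)) v + (-1) *\<^sub>C id v)"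
  have "x \<in> gauge_algebra M \<alpha> t"
    unfolding x_def using assms
    by (intro gauge_algebra_add gauge_algebra_cscale gauge_algebra_comp gauge_algebra_adj
        gauge_algebra_id gauge_algebra_generator U) auto
  moreover have "\<alpha> s (U h) v = adj (U s) (U (s + h) v)" for v
    using gauge_cocycle[OF U assms(1,2)] gauge_adj_cancel[OF U assms(1)] by simp
  then have "S s (increment U h) = x \<Omega>"
    using assms
    by (simp add: increment_def normal_cocycle_def bounded_ops_diff[OF S_ops] bounded_ops_cscale[OF S_ops]
        S_apply gauge_M[OF U] S_\<Omega> x_def cscale_minus_left flip: e_def)
  ultimately show ?thesis by blast
qed

lemma shift_sum_in_gauge_algebra:
  assumes "h \<ge> 0" "real N * h \<le> t"
  shows "\<exists>x\<in>gauge_algebra M \<alpha> t. shift_sum h (increment U h) N = x \<Omega>"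
  using assms(2)
proof (induction N)
  case 0
  show ?case
    using gauge_algebra_cscale[OF gauge_algebra_id, of 0]
    by (intro bexI[of _ "\<lambda>v. 0 *\<^sub>C id v"]) (simp_all add: shift_sum_zero)
next
  case (Suc N)
  have N: "real N * h + h \<le> t"
    using Suc.prems by (simp add: algebra_simps)
  then have "real N * h \<le> t"
    using assms(1) by linarith
  then obtain x where x: "x \<in> gauge_algebra M \<alpha> t" "shift_sum h (increment U h) N = x \<Omega>"
    using Suc.IH by blast
  obtain y where y: "y \<in> gauge_algebra M \<alpha> t" "S (real N * h) (increment U h) = y \<Omega>"
    using shifted_increment_in_gauge_algebra[OF _ assms(1) N] assms(1) by auto
  show ?case
    using gauge_algebra_add[OF x(1) y(1)] x(2) y(2)
    by (intro bexI[of _ "\<lambda>v. x v + y v"]) (simp_all add: shift_sum_Suc)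
qed

lemma additive_part_gauge_space:
  assumes t: "t \<ge> 0"
  shows "additive_part U t \<in> gauge_space M \<Omega> \<alpha> t"
proof -
  have "approx U n t \<in> gauge_space M \<Omega> \<alpha> t" for n
    using shift_sum_in_gauge_algebra[OF mesh_nonneg steps_mesh_le[OF t], of n]
    unfolding gauge_space_def approx_def by (auto intro!: subsetD[OF closure_subset])
  then show ?thesis
    by (rule closed_sequentially[rotated 1, OF _ approx_tendsto[OF t]]) (simp add: gauge_space_def)
qed

lemma cinner_\<Omega>_additive_part:
  assumes t: "t \<ge> 0"
  shows "cinner \<Omega> (additive_part U t) = 0"
proof -
  have "cinner \<Omega> (S s (increment U h)) = 0" if "s \<ge> 0" "h \<ge> 0" for s h
    using cinner_S[OF that(1), of \<Omega> "increment U h"] increment_op(5)[OF U that(2)]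
    by (simp add: S_\<Omega>[OF that(1)])
  then have "cinner \<Omega> (approx U n t) = 0" for n
    by (simp add: approx_def shift_sum_def cinner_sum_right mesh_nonneg)
  then have "(\<lambda>n. 0) \<longlonglongrightarrow> cinner \<Omega> (additive_part U t)"
    using tendsto_cinner[OF tendsto_const approx_tendsto[OF t], of \<Omega>] by simp
  then show ?thesis
    by (simp add: LIMSEQ_const_iff)
qed

lemma additive_part_centred: "centred_additive_cocycle M \<Omega> \<alpha> (additive_part U)"
  unfolding centred_additive_cocycle_def additive_cocycle_def
  using continuous_additive_part
  by (auto intro: borel_measurable_continuous_on_restrict
      simp: additive_part_gauge_space additive_part_add cinner_\<Omega>_additive_part)

end

subsection \<open>The isometry\<close>

definition gauge_map :: "((real \<Rightarrow> 'h \<Rightarrow> 'h) \<Rightarrow> complex) \<Rightarrow> 'h" where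
  "gauge_map f = (\<Sum>U\<in>supp f. f U *\<^sub>C additive_part U 1)"

text \<open>Cancellation can shrink the support of a sum of functions, so linearity is checked over
  a common finite set.\<close>

lemma gauge_map_superset:
  assumes "finite A" "supp f \<subseteq> A"
  shows "gauge_map f = (\<Sum>U\<in>A. f U *\<^sub>C additive_part U 1)"
  unfolding gauge_map_def using assms by (intro sum.mono_neutral_left) (auto simp: supp_def)

lemma sum_supp_superset:
  assumes "finite A" "supp f \<subseteq> A"
  shows "(\<Sum>U\<in>supp f. f U) = (\<Sum>U\<in>A. f U)"
  using assms by (intro sum.mono_neutral_left) (auto simp: supp_def)

text \<open>On functions of total weight zero the terms of \<open>reduced_c U V\<close> that depend on only one of
  \<open>U\<close> and \<open>V\<close> cancel.\<close>

lemma cinner_gauge_map: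
  assumes f: "f \<in> vecs (gauge_prehilbert M \<Omega> \<alpha>)" and g: "g \<in> vecs (gauge_prehilbert M \<Omega> \<alpha>)"
  shows "cinner (gauge_map f) (gauge_map g) = form (gauge_prehilbert M \<Omega> \<alpha>) f g"
proof -
  define a where "a U = c_star \<Omega> trivial_cocycle U" for U
  have sf: "supp f \<subseteq> gauge_cocycles M \<alpha>" "(\<Sum>U\<in>supp f. f U) = 0"
    and sg: "supp g \<subseteq> gauge_cocycles M \<alpha>" "(\<Sum>U\<in>supp g. g U) = 0"
    using f g by (simp_all add: gauge_prehilbert_def)
  have f0: "(\<Sum>U\<in>supp f. cnj (f U)) = 0"
    using sf(2) by (simp flip: cnj_sum)
  have inner: "cinner (additive_part U 1) (additive_part V 1) = c_star \<Omega> U V - cnj (a U) - a V"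
    if "U \<in> supp f" "V \<in> supp g" for U V
    using cinner_additive_part[of U V 1, OF _ _ _ approx_tendsto] that sf sg
    by (auto simp: reduced_c_def a_def subset_iff)
  have "cinner (gauge_map f) (gauge_map g) =
      (\<Sum>U\<in>supp f. \<Sum>V\<in>supp g. cnj (f U) * (g V * cinner (additive_part U 1) (additive_part V 1)))"
    unfolding gauge_map_def cinner_sum_left cinner_cscale_left
    unfolding cinner_sum_right cinner_cscale_right sum_distrib_left ..
  also have "\<dots> =
      (\<Sum>U\<in>supp f. \<Sum>V\<in>supp g. cnj (f U) * (g V * (c_star \<Omega> U V - cnj (a U) - a V)))"
    by (intro sum.cong refl) (simp only: inner)
  also have "\<dots> = (\<Sum>U\<in>supp f. \<Sum>V\<in>supp g. c_star \<Omega> U V * cnj (f U) * g V)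
      - (\<Sum>U\<in>supp f. cnj (f U) * cnj (a U)) * (\<Sum>V\<in>supp g. g V)
      - (\<Sum>U\<in>supp f. cnj (f U)) * (\<Sum>V\<in>supp g. g V * a V)"
    unfolding sum_product by (simp add: algebra_simps sum.distrib sum_subtractf)
  finally show ?thesis
    by (simp add: f0 sg(2) gauge_prehilbert_def)
qed

lemma represents_gauge_map: "represents (gauge_prehilbert M \<Omega> \<alpha>) gauge_map"
  unfolding represents_def
proof (intro conjI ballI allI)
  let ?E = "gauge_prehilbert M \<Omega> \<alpha>"
  show "form ?E f g = cinner (gauge_map f) (gauge_map g)" if "f \<in> vecs ?E" "g \<in> vecs ?E" for f g
    using cinner_gauge_map[OF that] by simp
  fix f g assume fg: "f \<in> vecs ?E" "g \<in> vecs ?E"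
  define A where "A = supp f \<union> supp g"
  have A: "finite A" "supp f \<subseteq> A" "supp g \<subseteq> A" "supp (\<lambda>U. f U + g U) \<subseteq> A" "A \<subseteq> gauge_cocycles M \<alpha>"
    using fg by (auto simp: A_def gauge_prehilbert_def supp_def)
  show "vadd ?E f g \<in> vecs ?E"
    using fg A sum_supp_superset[OF A(1,2)] sum_supp_superset[OF A(1,3)] sum_supp_superset[OF A(1,4)]
    by (auto simp: gauge_prehilbert_def sum.distrib intro: finite_subset)
  show "gauge_map (vadd ?E f g) = gauge_map f + gauge_map g"
    using gauge_map_superset[OF A(1,2)] gauge_map_superset[OF A(1,3)] gauge_map_superset[OF A(1,4)]
    by (simp add: gauge_prehilbert_def cscale_add_left sum.distrib)
next
  let ?E = "gauge_prehilbert M \<Omega> \<alpha>"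
  fix c f assume f: "f \<in> vecs ?E"
  have A: "finite (supp f)" "supp (\<lambda>U. c * f U) \<subseteq> supp f"
    using f by (auto simp: gauge_prehilbert_def supp_def)
  show "vscale ?E c f \<in> vecs ?E"
    using f A sum_supp_superset[OF A]
    by (auto simp: gauge_prehilbert_def simp flip: sum_distrib_left intro: finite_subset)
  show "gauge_map (vscale ?E c f) = c *\<^sub>C gauge_map f"
    using gauge_map_superset[OF A]
    by (simp add: gauge_prehilbert_def gauge_map_def cscale_sum_right cscale_cscale)
qed

lemma gauge_map_in_span:
  assumes "f \<in> vecs (gauge_prehilbert M \<Omega> \<alpha>)"
  shows "gauge_map f \<in> module.span cscale {b 1 | b. centred_additive_cocycle M \<Omega> \<alpha> b}"
proof -
  interpret vector_space "cscale :: complex \<Rightarrow> 'h \<Rightarrow> 'h"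
    by (rule vector_space_cscale)
  show ?thesis
    unfolding gauge_map_def
    by (intro span_sum span_scale span_base)
       (use assms additive_part_centred in \<open>auto simp: gauge_prehilbert_def\<close>)
qed

end

theorem corollary6p9:
  fixes M :: "('h::chilbert_space \<Rightarrow> 'h) set"
    and \<Omega> :: 'h
    and \<alpha> :: "real \<Rightarrow> ('h \<Rightarrow> 'h) \<Rightarrow> ('h \<Rightarrow> 'h)"
  assumes "II1_factor M"
    and "acts_standardly M \<Omega>"
    and "E0_semigroup M \<alpha>"
  shows "\<exists>D. linear_isometry (gauge_hilbert M \<Omega> \<alpha>) D \<and>
           D ` vecs (gauge_hilbert M \<Omega> \<alpha>) \<subseteq>
             closure (module.span cscale {b 1 | b. centred_additive_cocycle M \<Omega> \<alpha> b})"
proof -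
  interpret tracial_E0_semigroup M \<Omega> \<alpha>
    using assms by unfold_locales (simp_all add: II1_factor_def)
  obtain D where D: "linear_isometry (gauge_hilbert M \<Omega> \<alpha>) D"
    "D ` vecs (gauge_hilbert M \<Omega> \<alpha>) \<subseteq> closure (gauge_map ` vecs (gauge_prehilbert M \<Omega> \<alpha>))"
    using linear_isometry_hilbert_completion[OF represents_gauge_map] unfolding gauge_hilbert_def by blast
  have "gauge_map ` vecs (gauge_prehilbert M \<Omega> \<alpha>) \<subseteq>
      module.span cscale {b 1 | b. centred_additive_cocycle M \<Omega> \<alpha> b}"
    using gauge_map_in_span by blast
  then show ?thesis
    using D closure_mono by blast
qed

end
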